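(* Let $A=(A_1,\dots,A_5):I\to\mathbb{R}^{3\times5}$ be smooth on an open interval $I$, with columns linearly independent over $\mathbb{R}$ (as functions on $I$), such that $$p_{123}=1,\quad p_{345}=-1,\quad p_{135}=p_{234}=0,\quad p_{124}=p_{125}=p_{145}=p_{245}=0,$$ and every $Q_{ij}$ ($1\le i<j\le5$) is constant. Then, up to replacing $A$ by $AH$ with a constant invertible $5\times5$ matrix $H$ that preserves the spatial constraints $g_{134}=g_{235}=0$ and the determinant conditions $p_{123}=1$, $p_{345}=-1$, $p_{135}=p_{234}=0$, $p_{124}=p_{125}=p_{145}=p_{245}=0$, $A=RB$ with $R(t)\in SO(3)$ and $$B=\begin{pmatrix}b_{11}&b_{12}&b_{13}&b_{12}/\ell&\ell b_{11}\\0&b_{22}&b_{23}&b_{22}/\ell&0\\0&0&1/(b_{11}b_{22})&0&0\end{pmatrix},$$ where $w=0$ (that is, $R$ is constant) and $$\ell'=-\frac1{b_{11}^2},\qquad b_{22}=\ell b_{11},\qquad b_{12}=b_{13}=b_{23}=0 .$$ Conversely, every $A=RB$ of this form (with $b_{11}$ and $\ell$ nowhere zero) has columns linearly independent over $\mathbb{R}$, satisfies $p_{123}=1$, $p_{345}=-1$, $p_{135}=p_{234}=0$, $p_{124}=p_{125}=p_{145}=p_{245}=0$, and has every $Q_{ij}$ ($1\le i<j\le5$) constant.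
   Context: For $A(t)\in\mathbb{R}^{3\times m}$ with columns $A_i$, set $p_{ijk}=\det(A_i,A_j,A_k)$ and $Q_{ij}=\langle A_i',A_j\rangle-\langle A_j',A_i\rangle$, $'=d/dt$. For a smooth $R(t)\in SO(3)$ the vector $w$ is defined by $R^TR'x=\tfrac12\,w\times x$ for all $x\in\mathbb{R}^3$. Origin: $\varphi(z,t)=A(t)v(z)$ is sought as a solution of the 3D incompressible Euler equations in Lagrangian form, with spatial constraints $g_{134}=g_{235}=0$, where $g_{ijk}=\det(\nabla v^i,\nabla v^j,\nabla v^k)$ (hyperbolic case; $v=(z_1,z_2,z_3,f^1(z_1,z_3),f^2(z_2,z_3))$). The stated conditions are the normalized constraints on the time component. A constant invertible matrix $H$ acts by $(A,v)\mapsto(AH,H^{-1}v)$, leaving $\varphi$ unchanged; it preserves the spatial constraints if $H^{-1}v$ satisfies them whenever $v$ does. Solutions with columns of $A$ linearly dependent over $\mathbb{R}$ are called reducible and discarded. *)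

theory Defs
  imports "HOL-Analysis.Analysis"
begin

text \<open>Matrices and vectors are indexed by the numeral types \<open>3\<close> and \<open>5\<close>, so
  \<open>M $ i $ j\<close> with \<open>i\<close> in \<open>{1,2,3}\<close> and \<open>j\<close> in \<open>{1,2,3,4,5}\<close> is the usual 1-based entry
  (in these types the last index coincides with \<open>0\<close>).\<close>

text \<open>On an open set of a Euclidean space, \<open>k\<close>-fold differentiability with all iterated directional
  derivatives again differentiable for every \<open>k\<close> is the same as being $C^\infty$.  The notion
  depends only on the values of the function on the open set.\<close>

primrec higher_differentiable_on ::
  "nat \<Rightarrow> 'a::euclidean_space set \<Rightarrow> ('a \<Rightarrow> 'b::real_normed_vector) \<Rightarrow> bool" where
  "higher_differentiable_on 0 S f \<longleftrightarrow> continuous_on S f"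
| "higher_differentiable_on (Suc k) S f \<longleftrightarrow>
     (\<forall>x\<in>S. f differentiable (at x)) \<and>
     (\<forall>d. higher_differentiable_on k S (\<lambda>x. frechet_derivative f (at x) d))"

definition smooth_on :: "'a::euclidean_space set \<Rightarrow> ('a \<Rightarrow> 'b::real_normed_vector) \<Rightarrow> bool" where
  "smooth_on S f \<longleftrightarrow> (\<forall>k. higher_differentiable_on k S f)"

definition det3 :: "real^3 \<Rightarrow> real^3 \<Rightarrow> real^3 \<Rightarrow> real" where
  "det3 x y z = det (transpose (vector [x, y, z] :: real^3^3))"

definition p :: "real^5^3 \<Rightarrow> 5 \<Rightarrow> 5 \<Rightarrow> 5 \<Rightarrow> real" where
  "p M i j k = det3 (column i M) (column j M) (column k M)"

definition det_conditions :: "real^5^3 \<Rightarrow> bool" where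
  "det_conditions M \<longleftrightarrow>
     p M 1 2 3 = 1 \<and> p M 3 4 5 = -1 \<and> p M 1 3 5 = 0 \<and> p M 2 3 4 = 0 \<and>
     p M 1 2 4 = 0 \<and> p M 1 2 5 = 0 \<and> p M 1 4 5 = 0 \<and> p M 2 4 5 = 0"

definition Q :: "(real \<Rightarrow> real^5^3) \<Rightarrow> 5 \<Rightarrow> 5 \<Rightarrow> real \<Rightarrow> real" where
  "Q A i j t =
     inner (vector_derivative (\<lambda>s. column i (A s)) (at t)) (column j (A t)) -
     inner (vector_derivative (\<lambda>s. column j (A s)) (at t)) (column i (A t))"

definition Q_constant_on :: "real set \<Rightarrow> (real \<Rightarrow> real^5^3) \<Rightarrow> bool" where
  "Q_constant_on I A \<longleftrightarrow>
     (\<forall>(i, j) \<in> {(1,2), (1,3), (1,4), (1,5), (2,3), (2,4), (2,5), (3,4), (3,5), (4,5)}.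
        Q A i j constant_on I)"

text \<open>Linear independence over the reals of the columns as functions on \<open>I\<close>, not pointwise.\<close>

definition columns_independent_on :: "real set \<Rightarrow> (real \<Rightarrow> real^5^3) \<Rightarrow> bool" where
  "columns_independent_on I A \<longleftrightarrow>
     (\<forall>c :: 5 \<Rightarrow> real. (\<forall>t\<in>I. (\<Sum>i\<in>UNIV. c i *\<^sub>R column i (A t)) = 0) \<longrightarrow> (\<forall>i. c i = 0))"

definition grad :: "(real^3 \<Rightarrow> real) \<Rightarrow> real^3 \<Rightarrow> real^3" where
  "grad f z = (\<chi> a. frechet_derivative f (at z) (axis a 1))"

definition g :: "(real^3 \<Rightarrow> real^5) \<Rightarrow> 5 \<Rightarrow> 5 \<Rightarrow> 5 \<Rightarrow> real^3 \<Rightarrow> real" where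
  "g v i j k z = det3 (grad (\<lambda>y. v y $ i) z) (grad (\<lambda>y. v y $ j) z) (grad (\<lambda>y. v y $ k) z)"

definition spatial_constraints_on :: "(real^3) set \<Rightarrow> (real^3 \<Rightarrow> real^5) \<Rightarrow> bool" where
  "spatial_constraints_on U v \<longleftrightarrow> (\<forall>z\<in>U. g v 1 3 4 z = 0 \<and> g v 2 3 5 z = 0)"

text \<open>Here \<open>v\<close> ranges over all smooth maps on open sets, not only over those of the form
  $(z_1,z_2,z_3,f^1(z_1,z_3),f^2(z_2,z_3))$, since that form is not kept by $v\mapsto H^{-1}v$.\<close>

definition preserves_spatial_constraints :: "real^5^5 \<Rightarrow> bool" where
  "preserves_spatial_constraints H \<longleftrightarrow>
     (\<forall>U v. open U \<and> smooth_on U v \<and> spatial_constraints_on U v \<longrightarrow>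
        spatial_constraints_on U (\<lambda>z. matrix_inv H *v v z))"

text \<open>The determinant conditions are pointwise in \<open>t\<close>, so it is enough to let \<open>M\<close> range over
  constant matrices.\<close>

definition preserves_det_conditions :: "real^5^5 \<Rightarrow> bool" where
  "preserves_det_conditions H \<longleftrightarrow> (\<forall>M. det_conditions M \<longrightarrow> det_conditions (M ** H))"

definition is_rotation_vector :: "(real \<Rightarrow> real^3^3) \<Rightarrow> real \<Rightarrow> real^3 \<Rightarrow> bool" where
  "is_rotation_vector R t w \<longleftrightarrow>
     (\<forall>x. (transpose (R t) ** vector_derivative R (at t)) *v x = (1/2) *\<^sub>R cross3 w x)"

definition B_matrix :: "real \<Rightarrow> real \<Rightarrow> real \<Rightarrow> real \<Rightarrow> real \<Rightarrow> real \<Rightarrow> real^5^3" where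
  "B_matrix b11 b12 b13 b22 b23 l = vector
     [vector [b11, b12, b13,             b12 / l, l * b11],
      vector [0,   b22, b23,             b22 / l, 0],
      vector [0,   0,   1 / (b11 * b22), 0,       0]]"

text \<open>Only \<open>b11\<close> and \<open>l\<close> are required to be smooth: the remaining entries are determined by them
  on \<open>I\<close>.  The constancy of \<open>R\<close> is expressed by \<open>w = 0\<close>.\<close>

definition is_normal_form_on ::
  "real set \<Rightarrow> (real \<Rightarrow> real^5^3) \<Rightarrow> (real \<Rightarrow> real^3^3) \<Rightarrow> (real \<Rightarrow> real^3) \<Rightarrow>
   (real \<Rightarrow> real) \<Rightarrow> (real \<Rightarrow> real) \<Rightarrow> (real \<Rightarrow> real) \<Rightarrow> (real \<Rightarrow> real) \<Rightarrow> (real \<Rightarrow> real) \<Rightarrow>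
   (real \<Rightarrow> real) \<Rightarrow> bool" where
  "is_normal_form_on I A R w b11 b12 b13 b22 b23 l \<longleftrightarrow>
     smooth_on I R \<and> smooth_on I b11 \<and> smooth_on I l \<and>
     (\<forall>t\<in>I.
        A t = R t ** B_matrix (b11 t) (b12 t) (b13 t) (b22 t) (b23 t) (l t) \<and>
        rotation_matrix (R t) \<and>
        is_rotation_vector R t (w t) \<and> w t = 0 \<and>
        b11 t \<noteq> 0 \<and> l t \<noteq> 0 \<and>
        (l has_real_derivative - 1 / (b11 t)\<^sup>2) (at t) \<and>
        b22 t = l t * b11 t \<and> b12 t = 0 \<and> b13 t = 0 \<and> b23 t = 0)"

end

theory Submission
  imports Defs
begin

text \<open>The determinant conditions force \<open>A\<^sub>4, A\<^sub>5\<close> into the plane of \<open>A\<^sub>1, A\<^sub>2\<close> and there onto the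
lines of \<open>A\<^sub>2\<close> and \<open>A\<^sub>1\<close>: they say exactly that \<open>A\<^sub>2 = l A\<^sub>4\<close> and \<open>A\<^sub>5 = l A\<^sub>1\<close> for a nowhere
vanishing function \<open>l\<close>, and that \<open>det (A\<^sub>1, A\<^sub>2, A\<^sub>3) = 1\<close> (\<open>det_conditions_iff\<close>).  So everything is
expressed by the three vectors \<open>A\<^sub>1, A\<^sub>4, A\<^sub>3\<close> and \<open>l\<close>.

The bracket \<open>\<langle>X', Y\<rangle> - \<langle>Y', X\<rangle>\<close> is skew, and scaling one argument by \<open>l\<close> multiplies it by \<open>l\<close> up to the
term \<open>l' \<langle>X, Y\<rangle>\<close>.  Comparing the brackets of a pair with those of the scaled pair therefore turns
the constancy of the \<open>Q\<^sub>i\<^sub>j\<close> into \<^emph>\<open>algebraic\<close> information about inner products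
(\<open>Q_identities\<close>).  First, \<open>l' \<langle>A\<^sub>1, A\<^sub>1\<rangle> = - Q\<^sub>1\<^sub>5\<close>; here \<open>Q\<^sub>1\<^sub>5 \<noteq> 0\<close>, because otherwise \<open>l\<close>
would be constant and \<open>A\<^sub>5 = l A\<^sub>1\<close> a linear dependence.  Hence \<open>l'\<close> has no zero.
Next, \<open>Q\<^sub>2\<^sub>5 = - l\<^sup>2 Q\<^sub>1\<^sub>4\<close> gives \<open>Q\<^sub>1\<^sub>4 = 0\<close>, and then \<open>l'\<close> times each of \<open>\<langle>A\<^sub>1, A\<^sub>1\<rangle>\<close>,
\<open>\<langle>A\<^sub>1, A\<^sub>4\<rangle>\<close>, \<open>\<langle>A\<^sub>4, A\<^sub>4\<rangle>\<close> is constant, while \<open>l'\<close> times \<open>\<langle>A\<^sub>1, A\<^sub>3\<rangle>\<close> or \<open>\<langle>A\<^sub>4, A\<^sub>3\<rangle>\<close> is an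
affine function of \<open>l\<close> with constant coefficients (\<open>gram_identities\<close>).

Gram--Schmidt is thus possible with \<^emph>\<open>constant\<close> coefficients.  The vector \<open>A\<^sub>4 - \<kappa> A\<^sub>1\<close> is orthogonal to
\<open>A\<^sub>1\<close> for a constant \<open>\<kappa>\<close>, and its length is a constant multiple of that of \<open>A\<^sub>1\<close>;  the component of
\<open>A\<^sub>3\<close> in the plane of \<open>A\<^sub>1, A\<^sub>4\<close> is a combination of \<open>A\<^sub>1\<close>, \<open>A\<^sub>5 = l A\<^sub>1\<close>, \<open>A\<^sub>4\<close>, \<open>A\<^sub>2 = l A\<^sub>4\<close>
with constant coefficients.  These operations preserve the two kinds of constraints, and together
with a rescaling they form the change of basis \<open>admissible_change\<close>; afterwards \<open>A\<^sub>1, A\<^sub>4, A\<^sub>3\<close> are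
orthogonal, \<open>A\<^sub>1\<close> and \<open>A\<^sub>4\<close> have equal length, and \<open>l' \<langle>A\<^sub>1, A\<^sub>1\<rangle> = -1\<close> (\<open>normalizing_change\<close>).

Rerunning the identities for the new columns shows \<open>Q\<^sub>1\<^sub>3 = Q\<^sub>3\<^sub>4 = Q\<^sub>1\<^sub>4 = 0\<close>.  For orthogonal vectors
a vanishing bracket means that each derivative is orthogonal to the other vector,
so \<open>A\<^sub>1'\<close> is parallel to \<open>A\<^sub>1\<close> and \<open>A\<^sub>4'\<close> to \<open>A\<^sub>4\<close>: the orthonormal frame is constant
(\<open>constant_direction\<close>), which is the assertion \<open>w = 0\<close>.

Conversely \<open>w = 0\<close> forces \<open>R\<close> to be constant, so that every column is a scalar function times one of
three constant orthonormal vectors.  Then all \<open>Q\<^sub>i\<^sub>j\<close> vanish except \<open>Q\<^sub>1\<^sub>5\<close> and \<open>Q\<^sub>2\<^sub>4\<close>, which equal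
\<open>- l' b\<^sub>1\<^sub>1\<^sup>2 = 1\<close> and \<open>l' b\<^sub>1\<^sub>1\<^sup>2 = -1\<close>.\<close>

section \<open>Coordinates and determinants\<close>

lemma exhaust_5: "x = 1 \<or> x = 2 \<or> x = 3 \<or> x = 4 \<or> x = 5" for x :: 5
proof (induct x)
  case (of_int z)
  then have "z = 0 \<or> z = 1 \<or> z = 2 \<or> z = 3 \<or> z = 4" by fastforce
  then show ?case by auto
qed

lemma forall_5: "(\<forall>i::5. P i) \<longleftrightarrow> P 1 \<and> P 2 \<and> P 3 \<and> P 4 \<and> P 5"
  by (metis exhaust_5)

lemma UNIV_5: "UNIV = {1, 2, 3, 4, 5::5}"
  using exhaust_5 by auto

lemma sum_5: "sum f (UNIV::5 set) = f 1 + f 2 + f 3 + f 4 + f 5"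
  unfolding UNIV_5 by (simp add: ac_simps)

lemma vector_5:
  "(vector [a, b, c, d, e] :: ('a::zero)^5) $ 1 = a"
  "(vector [a, b, c, d, e] :: ('a::zero)^5) $ 2 = b"
  "(vector [a, b, c, d, e] :: ('a::zero)^5) $ 3 = c"
  "(vector [a, b, c, d, e] :: ('a::zero)^5) $ 4 = d"
  "(vector [a, b, c, d, e] :: ('a::zero)^5) $ 5 = e"
  by (simp_all add: vector_def)

lemma det3_eq_triple_product: "det3 x y z = x \<bullet> cross3 y z"
  by (simp add: det3_def det_transpose dot_cross_det)

lemmas det3_coords = det3_eq_triple_product cross3_def inner_vec_def sum_3 vector_3

lemma det3_linear:
  "det3 (x + x') y z = det3 x y z + det3 x' y z"
  "det3 x (y + y') z = det3 x y z + det3 x y' z"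
  "det3 x y (z + z') = det3 x y z + det3 x y z'"
  "det3 (x - x') y z = det3 x y z - det3 x' y z"
  "det3 x (y - y') z = det3 x y z - det3 x y' z"
  "det3 x y (z - z') = det3 x y z - det3 x y z'"
  "det3 (c *\<^sub>R x) y z = c * det3 x y z"
  "det3 x (c *\<^sub>R y) z = c * det3 x y z"
  "det3 x y (c *\<^sub>R z) = c * det3 x y z"
  by (simp_all add: det3_coords algebra_simps)

lemma det3_repeated: "det3 x x y = 0" "det3 x y x = 0" "det3 y x x = 0"
  by (simp_all add: det3_coords algebra_simps)

text \<open>Cramer's rule without division, so that no basis needs to be assumed.\<close>

lemma cramer3:
  "det3 a b c *\<^sub>R v = det3 v b c *\<^sub>R a + det3 a v c *\<^sub>R b + det3 a b v *\<^sub>R c"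
  by (simp add: det3_coords vec_eq_iff forall_3 algebra_simps)

lemma eq_zero_if_orthogonal_to_basis:
  assumes "det3 x y z \<noteq> 0" "v \<bullet> x = 0" "v \<bullet> y = 0" "v \<bullet> z = 0"
  shows "v = 0"
proof -
  have "det3 x y z *\<^sub>R v = (v \<bullet> x) *\<^sub>R cross3 y z + (v \<bullet> y) *\<^sub>R cross3 z x + (v \<bullet> z) *\<^sub>R cross3 x y"
    by (simp add: det3_coords vec_eq_iff forall_3 algebra_simps)
  with assms show ?thesis by simp
qed

lemma column_matrix_mult: "column j (M ** H) = (\<Sum>i\<in>UNIV. H $ i $ j *\<^sub>R column i M)"
  for M :: "real^'n::finite^'m::finite" and H :: "real^'k::finite^'n"
  by (simp add: vec_eq_iff column_def matrix_matrix_mult_def mult.commute)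

lemma matrix_eqI_columns: "(\<And>j. column j M = column j N) \<Longrightarrow> M = N"
  by (simp add: vec_eq_iff column_def)

section \<open>The determinant conditions\<close>

text \<open>In the basis \<open>A\<^sub>1, A\<^sub>2, A\<^sub>3\<close> the vanishing determinants are coordinates of \<open>A\<^sub>4\<close> and \<open>A\<^sub>5\<close>, and by
Cramer's rule they leave only \<open>A\<^sub>4 = m A\<^sub>2\<close> and \<open>A\<^sub>5 = l A\<^sub>1\<close>.  The value \<open>p\<^sub>3\<^sub>4\<^sub>5 = -1\<close> then says that
\<open>m l = 1\<close>.  Writing \<open>A\<^sub>2\<close> as a multiple of \<open>A\<^sub>4\<close> makes the roles of \<open>A\<^sub>1, A\<^sub>5\<close> and \<open>A\<^sub>4, A\<^sub>2\<close> the same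
and avoids quotients later.\<close>

lemma det_conditions_iff:
  "det_conditions M \<longleftrightarrow> det3 (column 1 M) (column 2 M) (column 3 M) = 1 \<and>
     (\<exists>l. l \<noteq> 0 \<and> column 2 M = l *\<^sub>R column 4 M \<and> column 5 M = l *\<^sub>R column 1 M)"
  (is "?L \<longleftrightarrow> ?D = 1 \<and> ?R")
proof
  let ?a = "column 1 M" and ?b = "column 2 M" and ?c = "column 3 M"
    and ?x = "column 4 M" and ?y = "column 5 M"
  assume ?L
  then have D: "?D = 1" and D345: "det3 ?c ?x ?y = -1" and *: "det3 ?a ?c ?y = 0" "det3 ?b ?c ?x = 0"
    "det3 ?a ?b ?x = 0" "det3 ?a ?b ?y = 0"
    by (auto simp: det_conditions_def p_def)
  define m l where "m = det3 ?a ?x ?c" and "l = det3 ?y ?b ?c"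
  have "det3 ?x ?b ?c = det3 ?b ?c ?x" "det3 ?a ?y ?c = - det3 ?a ?c ?y"
    by (simp_all add: det3_coords algebra_simps)
  with * cramer3[of ?a ?b ?c ?x] cramer3[of ?a ?b ?c ?y] D
  have x: "?x = m *\<^sub>R ?b" and y: "?y = l *\<^sub>R ?a"
    by (simp_all add: m_def l_def)
  have "det3 ?c ?x ?y = - (m * l * det3 ?a ?b ?c)"
    unfolding x y by (simp add: det3_coords algebra_simps)
  with D D345 have ml: "m * l = 1" by simp
  then have "l \<noteq> 0" "?b = l *\<^sub>R ?x" by (auto simp: x mult.commute)
  with D y show "?D = 1 \<and> ?R" by blast
next
  assume *: "?D = 1 \<and> ?R"
  then obtain l where l: "l \<noteq> 0" "column 2 M = l *\<^sub>R column 4 M" "column 5 M = l *\<^sub>R column 1 M"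
    by blast
  have "det3 (column 3 M) (column 4 M) (l *\<^sub>R column 1 M) = - det3 (column 1 M) (l *\<^sub>R column 4 M) (column 3 M)"
    by (simp add: det3_coords algebra_simps)
  with * l show ?L
    by (auto simp: det_conditions_def p_def det3_linear det3_repeated)
qed

section \<open>Changes of basis that preserve the constraints\<close>

text \<open>The family acts on columns by \<open>A\<^sub>1 \<mapsto> A\<^sub>1\<close>, \<open>A\<^sub>4 \<mapsto> (A\<^sub>4 - \<kappa> A\<^sub>1) / r\<close>, adds to a multiple of \<open>A\<^sub>3\<close>
an arbitrary combination of the other columns, and lets \<open>A\<^sub>2, A\<^sub>5\<close> follow \<open>A\<^sub>4, A\<^sub>1\<close> with \<open>l\<close> replaced
by \<open>l / c\<close>; see \<open>columns_admissible_change\<close>.  The factor \<open>c * r\<close> of \<open>A\<^sub>3\<close> compensates the factor of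
\<open>A\<^sub>2\<close> in \<open>det (A\<^sub>1, A\<^sub>2, A\<^sub>3)\<close>.\<close>

definition admissible_change :: "real \<Rightarrow> real \<Rightarrow> real \<Rightarrow> real \<Rightarrow> real \<Rightarrow> real \<Rightarrow> real \<Rightarrow> real^5^5" where
  "admissible_change c r \<kappa> x1 x2 x4 x5 = vector
     [vector [1, 0,             x1,    - \<kappa> / r, 0],
      vector [0, 1 / (c * r),   x2,    0,       0],
      vector [0, 0,             c * r, 0,       0],
      vector [0, 0,             x4,    1 / r,   0],
      vector [0, - \<kappa> / (c * r), x5,    0,       1 / c]]"

text \<open>Column \<open>j\<close> lists the coefficients of the old column \<open>A\<^sub>j\<close> in terms of the new columns.\<close>

definition admissible_change_inv :: "real \<Rightarrow> real \<Rightarrow> real \<Rightarrow> real \<Rightarrow> real \<Rightarrow> real \<Rightarrow> real \<Rightarrow> real^5^5" where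
  "admissible_change_inv c r \<kappa> x1 x2 x4 x5 = vector
     [vector [1, 0,     - (x1 + \<kappa> * x4) / (c * r), \<kappa>, 0],
      vector [0, c * r, - x2,                      0, 0],
      vector [0, 0,     1 / (c * r),               0, 0],
      vector [0, 0,     - x4 / c,                  r, 0],
      vector [0, \<kappa> * c, - (x5 + \<kappa> * x2) / r,       0, c]]"

lemma columns_admissible_change:
  fixes M :: "real^5^3"
  defines "N c r \<kappa> x1 x2 x4 x5 \<equiv> M ** admissible_change c r \<kappa> x1 x2 x4 x5"
  shows "column 1 (N c r \<kappa> x1 x2 x4 x5) = column 1 M"
    "column 2 (N c r \<kappa> x1 x2 x4 x5) = (1 / (c * r)) *\<^sub>R (column 2 M - \<kappa> *\<^sub>R column 5 M)"
    "column 3 (N c r \<kappa> x1 x2 x4 x5) = (c * r) *\<^sub>R column 3 M + x1 *\<^sub>R column 1 M + x2 *\<^sub>R column 2 M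
       + x4 *\<^sub>R column 4 M + x5 *\<^sub>R column 5 M"
    "column 4 (N c r \<kappa> x1 x2 x4 x5) = (1 / r) *\<^sub>R (column 4 M - \<kappa> *\<^sub>R column 1 M)"
    "column 5 (N c r \<kappa> x1 x2 x4 x5) = (1 / c) *\<^sub>R column 5 M"
  by (simp_all add: N_def column_matrix_mult admissible_change_def sum_5 vector_5
      scaleR_diff_right algebra_simps)

lemma admissible_change_inverse:
  assumes "c \<noteq> 0" "r \<noteq> 0"
  shows "invertible (admissible_change c r \<kappa> x1 x2 x4 x5)"
    and "matrix_inv (admissible_change c r \<kappa> x1 x2 x4 x5) = admissible_change_inv c r \<kappa> x1 x2 x4 x5"
proof -
  let ?H = "admissible_change c r \<kappa> x1 x2 x4 x5" and ?K = "admissible_change_inv c r \<kappa> x1 x2 x4 x5"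
  have HK: "?H ** ?K = mat 1"
    using assms by (simp add: admissible_change_def admissible_change_inv_def vec_eq_iff
       matrix_matrix_mult_def forall_5 sum_5 vector_5 mat_def field_simps)
  then have KH: "?K ** ?H = mat 1" by (simp add: matrix_left_right_inverse)
  from HK KH show inv: "invertible ?H" by (auto simp: invertible_def)
  have "matrix_inv ?H ** ?H = mat 1"
    unfolding matrix_inv_def by (rule someI2[of _ ?K]) (use HK KH in auto)
  with HK show "matrix_inv ?H = ?K"
    by (metis matrix_mul_assoc matrix_mul_lid matrix_mul_rid)
qed

text \<open>Multiples of \<open>A\<^sub>1, A\<^sub>2, A\<^sub>4, A\<^sub>5\<close>, all in one plane, do not change the determinant when added to \<open>A\<^sub>3\<close>,
and the proportionality \<open>A\<^sub>5 = l A\<^sub>1\<close>, \<open>A\<^sub>2 = l A\<^sub>4\<close> is kept with the factor \<open>l / c\<close>.\<close>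

lemma preserves_det_conditions_admissible_change:
  assumes "c \<noteq> 0" "r \<noteq> 0"
  shows "preserves_det_conditions (admissible_change c r \<kappa> x1 x2 x4 x5)"
  unfolding preserves_det_conditions_def
proof (intro allI impI)
  fix M assume "det_conditions M"
  then obtain l where "det3 (column 1 M) (column 2 M) (column 3 M) = 1" and
    l: "l \<noteq> 0" "column 2 M = l *\<^sub>R column 4 M" "column 5 M = l *\<^sub>R column 1 M"
    by (auto simp: det_conditions_iff)
  with assms show "det_conditions (M ** admissible_change c r \<kappa> x1 x2 x4 x5)"
    unfolding det_conditions_iff columns_admissible_change
    by (intro conjI exI[of _ "l / c"])
      (simp_all add: det3_linear det3_repeated algebra_simps divide_simps)
qed

lemma smooth_on_imp_differentiable: "smooth_on S f \<Longrightarrow> x \<in> S \<Longrightarrow> f differentiable (at x)"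
  unfolding smooth_on_def using higher_differentiable_on.simps(2) by blast

lemma grad_matrix_vector_mult:
  fixes v :: "real^3 \<Rightarrow> real^5"
  assumes "v differentiable (at z)"
  shows "grad (\<lambda>y. (K *v v y) $ i) z = (\<Sum>j\<in>UNIV. K $ i $ j *\<^sub>R grad (\<lambda>y. v y $ j) z)"
proof -
  define D where "D = frechet_derivative v (at z)"
  have D: "(v has_derivative D) (at z)"
    using assms by (simp add: D_def frechet_derivative_works)
  have "((\<lambda>y. v y $ j) has_derivative (\<lambda>d. D d $ j)) (at z)" for j
    by (rule bounded_linear.has_derivative[OF bounded_linear_vec_nth D])
  then have 1: "frechet_derivative (\<lambda>y. v y $ j) (at z) = (\<lambda>d. D d $ j)" for j
    by (metis frechet_derivative_at)
  have "((\<lambda>y. (K *v v y) $ i) has_derivative (\<lambda>d. (K *v D d) $ i)) (at z)"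
    by (rule bounded_linear.has_derivative[OF _ D])
      (simp add: bounded_linear_compose[OF bounded_linear_vec_nth] matrix_vector_mul_bounded_linear)
  then have 2: "frechet_derivative (\<lambda>y. (K *v v y) $ i) (at z) = (\<lambda>d. (K *v D d) $ i)"
    by (metis frechet_derivative_at)
  show ?thesis
    unfolding grad_def 1 2 by (simp add: vec_eq_iff matrix_vector_mult_def)
qed

text \<open>The rows of the inverse with index in \<open>{1, 3, 4}\<close> involve only the components 1, 3, 4 of \<open>v\<close>,
and those with index in \<open>{2, 3, 5}\<close> only the components 2, 3, 5.  So each new determinant of
gradients is a constant multiple of the old one.\<close>

lemma preserves_spatial_constraints_admissible_change:
  assumes "c \<noteq> 0" "r \<noteq> 0"
  shows "preserves_spatial_constraints (admissible_change c r \<kappa> x1 x2 x4 x5)"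
  unfolding preserves_spatial_constraints_def
proof (intro allI impI)
  fix U v assume *: "open U \<and> smooth_on U v \<and> spatial_constraints_on U v"
  show "spatial_constraints_on U (\<lambda>z. matrix_inv (admissible_change c r \<kappa> x1 x2 x4 x5) *v v z)"
    unfolding spatial_constraints_on_def
  proof
    fix z assume "z \<in> U"
    with * have dz: "v differentiable (at z)" and
      g: "det3 (grad (\<lambda>y. v y $ 1) z) (grad (\<lambda>y. v y $ 3) z) (grad (\<lambda>y. v y $ 4) z) = 0"
         "det3 (grad (\<lambda>y. v y $ 2) z) (grad (\<lambda>y. v y $ 3) z) (grad (\<lambda>y. v y $ 5) z) = 0"
      by (auto simp: smooth_on_imp_differentiable spatial_constraints_on_def g_def)
    have "det3 x y w = 0 \<Longrightarrow> det3 w y x = 0" for x y w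
      by (simp add: det3_coords algebra_simps)
    with g show "g (\<lambda>z. matrix_inv (admissible_change c r \<kappa> x1 x2 x4 x5) *v v z) 1 3 4 z = 0 \<and>
          g (\<lambda>z. matrix_inv (admissible_change c r \<kappa> x1 x2 x4 x5) *v v z) 2 3 5 z = 0"
      unfolding g_def admissible_change_inverse[OF assms] grad_matrix_vector_mult[OF dz]
      by (simp add: admissible_change_inv_def sum_5 vector_5 det3_linear det3_repeated)
  qed
qed

section \<open>Products and linear images of smooth functions\<close>

lemma higher_differentiable_on_cong:
  assumes "open S" "\<And>x. x \<in> S \<Longrightarrow> f x = h x" "higher_differentiable_on k S f"
  shows "higher_differentiable_on k S h"
  using assms(2,3)
proof (induction k arbitrary: f h)
  case 0
  then show ?case by (simp cong: continuous_on_cong_simp)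
next
  case (Suc k)
  have D: "(h has_derivative frechet_derivative f (at x)) (at x)" if "x \<in> S" for x
  proof (rule has_derivative_transform_within_open[OF _ \<open>open S\<close> that])
    show "(f has_derivative frechet_derivative f (at x)) (at x)"
      using Suc.prems(2) that by (simp add: frechet_derivative_works)
  qed (simp add: Suc.prems(1))
  then have "frechet_derivative f (at x) = frechet_derivative h (at x)" if "x \<in> S" for x
    using frechet_derivative_at that by blast
  then show ?case
    using Suc.prems(2) D Suc.IH[of "\<lambda>x. frechet_derivative f (at x) _" "\<lambda>x. frechet_derivative h (at x) _"]
    by (auto simp: differentiable_def)
qed

text \<open>Any explicit formula for the derivative may be used in place of the Frechet derivative, which is the
form in which the differentiation rules are available.\<close>

lemma higher_differentiable_on_SucI:
  assumes "open S" and D: "\<And>x. x \<in> S \<Longrightarrow> (f has_derivative f' x) (at x)"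
    and "\<And>d. higher_differentiable_on k S (\<lambda>x. f' x d)"
  shows "higher_differentiable_on (Suc k) S f"
proof -
  have "f' x = frechet_derivative f (at x)" if "x \<in> S" for x
    using D[OF that] by (rule frechet_derivative_at)
  then have "higher_differentiable_on k S (\<lambda>x. frechet_derivative f (at x) d)" for d
    by (intro higher_differentiable_on_cong[OF \<open>open S\<close> _ assms(3)[of d]]) simp
  moreover have "f differentiable (at x)" if "x \<in> S" for x
    using D[OF that] by (rule differentiableI)
  ultimately show ?thesis by simp
qed

lemma higher_differentiable_on_SucD:
  assumes "higher_differentiable_on (Suc k) S f"
  shows "x \<in> S \<Longrightarrow> (f has_derivative frechet_derivative f (at x)) (at x)"
    and "higher_differentiable_on k S (\<lambda>x. frechet_derivative f (at x) d)"
  using assms by (simp_all flip: frechet_derivative_works)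

lemma higher_differentiable_on_Suc_imp:
  "higher_differentiable_on (Suc k) S f \<Longrightarrow> higher_differentiable_on k S f"
proof (induction k arbitrary: f)
  case 0
  then show ?case
    by (auto intro!: continuous_at_imp_continuous_on differentiable_imp_continuous_within)
next
  case (Suc k)
  then show ?case
    unfolding higher_differentiable_on.simps(2)[of "Suc k"] higher_differentiable_on.simps(2)[of k S f]
    by blast
qed

lemma higher_differentiable_on_linear:
  assumes "open S" "bounded_linear L" "higher_differentiable_on k S f"
  shows "higher_differentiable_on k S (\<lambda>x. L (f x))"
  using assms(3)
proof (induction k arbitrary: f)
  case 0
  then show ?case
    using assms(2) by (simp add: bounded_linear.continuous_on)
next
  case (Suc k)
  note D = higher_differentiable_on_SucD[OF Suc.prems]
  show ?case
    by (rule higher_differentiable_on_SucI[OF assms(1) bounded_linear.has_derivative[OF assms(2) D(1)]])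
      (assumption, rule Suc.IH[OF D(2)])
qed

lemma higher_differentiable_on_add:
  assumes "open S" "higher_differentiable_on k S f" "higher_differentiable_on k S h"
  shows "higher_differentiable_on k S (\<lambda>x. f x + h x)"
  using assms(2,3)
proof (induction k arbitrary: f h)
  case 0
  then show ?case by (simp add: continuous_on_add)
next
  case (Suc k)
  note D = higher_differentiable_on_SucD[OF Suc.prems(1)] and E = higher_differentiable_on_SucD[OF Suc.prems(2)]
  show ?case
    by (rule higher_differentiable_on_SucI[OF assms(1) has_derivative_add[OF D(1) E(1)]])
      (assumption, assumption, rule Suc.IH[OF D(2) E(2)])
qed

lemma higher_differentiable_on_mult:
  fixes f h :: "'a::euclidean_space \<Rightarrow> real"
  assumes "open S" "higher_differentiable_on k S f" "higher_differentiable_on k S h"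
  shows "higher_differentiable_on k S (\<lambda>x. f x * h x)"
  using assms(2,3)
proof (induction k arbitrary: f h)
  case 0
  then show ?case by (simp add: continuous_on_mult)
next
  case (Suc k)
  note D = higher_differentiable_on_SucD[OF Suc.prems(1)] and E = higher_differentiable_on_SucD[OF Suc.prems(2)]
  have fh: "higher_differentiable_on k S f" "higher_differentiable_on k S h"
    by (rule higher_differentiable_on_Suc_imp, rule Suc.prems)+
  show ?case
    by (rule higher_differentiable_on_SucI[OF assms(1) has_derivative_mult[OF D(1) E(1)]])
      (assumption, assumption, rule higher_differentiable_on_add[OF assms(1) Suc.IH[OF fh(1) E(2)] Suc.IH[OF D(2) fh(2)]])
qed

lemma smooth_on_linear:
  "open S \<Longrightarrow> bounded_linear L \<Longrightarrow> smooth_on S f \<Longrightarrow> smooth_on S (\<lambda>x. L (f x))"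
  by (simp add: smooth_on_def higher_differentiable_on_linear)

lemma smooth_on_mult:
  fixes f h :: "'a::euclidean_space \<Rightarrow> real"
  shows "open S \<Longrightarrow> smooth_on S f \<Longrightarrow> smooth_on S h \<Longrightarrow> smooth_on S (\<lambda>x. f x * h x)"
  by (simp add: smooth_on_def higher_differentiable_on_mult)

lemma smooth_on_const: "smooth_on S (\<lambda>_. c)"
proof -
  have "higher_differentiable_on k S (\<lambda>_. c)" for k
    by (induction k arbitrary: c) (simp_all add: frechet_derivative_const)
  then show ?thesis by (simp add: smooth_on_def)
qed

section \<open>The skew bracket of two curves\<close>

text \<open>This is \<open>Q\<close> for two arbitrary curves, so that the columns \<open>A\<^sub>2\<close> and \<open>A\<^sub>5\<close> can be replaced by multiples of
\<open>A\<^sub>4\<close> and \<open>A\<^sub>1\<close>.\<close>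

definition bracket :: "(real \<Rightarrow> real^3) \<Rightarrow> (real \<Rightarrow> real^3) \<Rightarrow> real \<Rightarrow> real" where
  "bracket X Y t = vector_derivative X (at t) \<bullet> Y t - vector_derivative Y (at t) \<bullet> X t"

lemma Q_eq_bracket: "Q A i j = bracket (\<lambda>s. column i (A s)) (\<lambda>s. column j (A s))"
  by (simp add: fun_eq_iff Q_def bracket_def)

lemma bracket_skew: "bracket Y X t = - bracket X Y t"
  by (simp add: bracket_def)

lemma bracket_self: "bracket X X t = 0"
  by (simp add: bracket_def)

lemma vector_derivative_cong_open:
  assumes "open I" "t \<in> I" "\<And>s. s \<in> I \<Longrightarrow> X s = Y s"
  shows "vector_derivative X (at t) = vector_derivative Y (at t)"
  using assms by (intro vector_derivative_cong_eq) (auto simp: eventually_nhds)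

lemma bracket_cong:
  assumes "open I" "t \<in> I" "\<And>s. s \<in> I \<Longrightarrow> X s = X' s" "\<And>s. s \<in> I \<Longrightarrow> Y s = Y' s"
  shows "bracket X Y t = bracket X' Y' t"
  using vector_derivative_cong_open[OF assms(1-3)] vector_derivative_cong_open[OF assms(1,2,4)]
    assms(2-4) by (simp add: bracket_def)

text \<open>The source of all the identities below: the bracket of a rescaled curve differs from the
rescaled bracket by an inner product.\<close>

lemma bracket_scaleR_left:
  assumes "(l has_real_derivative l') (at t)" "X differentiable (at t)"
  shows "bracket (\<lambda>s. l s *\<^sub>R X s) Y t = l t * bracket X Y t + l' * (X t \<bullet> Y t)"
proof -
  have "((\<lambda>s. l s *\<^sub>R X s) has_vector_derivative
      l t *\<^sub>R vector_derivative X (at t) + l' *\<^sub>R X t) (at t)"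
    using assms by (intro has_vector_derivative_scaleR) (simp_all add: vector_derivative_works)
  then have "vector_derivative (\<lambda>s. l s *\<^sub>R X s) (at t) = l t *\<^sub>R vector_derivative X (at t) + l' *\<^sub>R X t"
    by (rule vector_derivative_at)
  then show ?thesis
    by (simp add: bracket_def inner_add_left inner_add_right algebra_simps)
qed

lemma bracket_scaled_constants:
  assumes "(f has_real_derivative f') (at t)" "(h has_real_derivative h') (at t)"
  shows "bracket (\<lambda>s. f s *\<^sub>R u) (\<lambda>s. h s *\<^sub>R v) t = (f' * h t - h' * f t) * (u \<bullet> v)"
proof -
  have "vector_derivative (\<lambda>s. f s *\<^sub>R u) (at t) = f' *\<^sub>R u" "vector_derivative (\<lambda>s. h s *\<^sub>R v) (at t) = h' *\<^sub>R v"
    using has_vector_derivative_scaleR[OF assms(1) has_vector_derivative_const, of u]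
      has_vector_derivative_scaleR[OF assms(2) has_vector_derivative_const, of v]
    by (simp_all add: vector_derivative_at)
  then show ?thesis by (simp add: bracket_def inner_commute algebra_simps)
qed

lemma Q_constant_on_iff:
  "Q_constant_on I A \<longleftrightarrow> (\<forall>i j. Q A i j constant_on I)"
proof
  assume *: "Q_constant_on I A"
  have skew: "Q A j i constant_on I" if "Q A i j constant_on I" for i j
  proof -
    from that obtain q where "\<forall>t\<in>I. Q A i j t = q" by (auto simp: constant_on_def)
    then have "\<forall>t\<in>I. Q A j i t = - q"
      by (metis Q_eq_bracket bracket_skew)
    then show ?thesis by (auto simp: constant_on_def)
  qed
  have self: "Q A i i constant_on I" for i
    by (auto simp: constant_on_def Q_eq_bracket bracket_self)
  show "\<forall>i j. Q A i j constant_on I"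
    unfolding forall_5 using * skew self by (simp add: Q_constant_on_def)
qed (simp add: Q_constant_on_def)

lemma bounded_linear_column: "bounded_linear (column j :: real^'n::finite^'m::finite \<Rightarrow> real^'m)"
  by (rule linear_conv_bounded_linear[THEN iffD1], rule linearI) (simp_all add: column_def vec_eq_iff)

lemma differentiable_column:
  fixes A :: "real \<Rightarrow> real^'n::finite^'m::finite"
  assumes "A differentiable (at t)"
  shows "(\<lambda>s. column j (A s)) differentiable (at t)"
  using assms bounded_linear.has_derivative[OF bounded_linear_column] unfolding differentiable_def by blast

lemma bounded_linear_matrix_mult_right: "bounded_linear (\<lambda>M :: real^'n::finite^'m::finite. M ** (H :: real^'k::finite^'n))"
  by (rule linear_conv_bounded_linear[THEN iffD1], rule linearI)
    (simp_all add: matrix_matrix_mult_def vec_eq_iff sum.distrib sum_distrib_left algebra_simps)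

text \<open>The bracket is bilinear over the constants, hence \<open>Q\<close> transforms like a bilinear form, and constancy
of all its entries is invariant under constant changes of basis.\<close>

lemma Q_matrix_mult:
  assumes "A differentiable (at t)"
  shows "Q (\<lambda>s. A s ** H) i j t = (\<Sum>k\<in>UNIV. \<Sum>m\<in>UNIV. H $ k $ i * H $ m $ j * Q A k m t)"
proof -
  have "((\<lambda>s. column j (A s ** H)) has_vector_derivative
      (\<Sum>k\<in>UNIV. H $ k $ j *\<^sub>R vector_derivative (\<lambda>s. column k (A s)) (at t))) (at t)" for j
    unfolding column_matrix_mult
    by (intro has_vector_derivative_sum bounded_linear.has_vector_derivative[OF bounded_linear_scaleR_right])
      (simp add: vector_derivative_works[symmetric] differentiable_column[OF assms])
  then have D: "vector_derivative (\<lambda>s. column j (A s ** H)) (at t)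
      = (\<Sum>k\<in>UNIV. H $ k $ j *\<^sub>R vector_derivative (\<lambda>s. column k (A s)) (at t))" for j
    by (rule vector_derivative_at)
  have "(\<Sum>m\<in>UNIV. \<Sum>k\<in>UNIV. F k m) = (\<Sum>k\<in>UNIV. \<Sum>m\<in>UNIV. F k m)" for F :: "5 \<Rightarrow> 5 \<Rightarrow> real"
    by (rule sum.swap)
  note sw = this
  show ?thesis
    unfolding Q_def D unfolding column_matrix_mult
    by (simp add: inner_sum_left inner_sum_right sum_distrib_left right_diff_distrib sum_subtractf mult.assoc)
      (subst sw, simp add: mult.left_commute)
qed

lemma Q_constant_on_matrix_mult:
  assumes "\<And>t. t \<in> I \<Longrightarrow> A differentiable (at t)" "Q_constant_on I A"
  shows "Q_constant_on I (\<lambda>t. A t ** H)"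
  unfolding Q_constant_on_iff
proof (intro allI)
  fix i j
  from assms(2) obtain q where "\<And>k m t. t \<in> I \<Longrightarrow> Q A k m t = q k m"
    unfolding Q_constant_on_iff constant_on_def by metis
  then show "Q (\<lambda>t. A t ** H) i j constant_on I"
    unfolding constant_on_def using assms(1)
    by (intro exI[of _ "\<Sum>k\<in>UNIV. \<Sum>m\<in>UNIV. H $ k $ i * H $ m $ j * q k m"]) (simp add: Q_matrix_mult)
qed

lemma columns_independent_on_matrix_mult:
  assumes "invertible H" "columns_independent_on I A"
  shows "columns_independent_on I (\<lambda>t. A t ** H)"
  unfolding columns_independent_on_def
proof (intro allI impI)
  fix c :: "5 \<Rightarrow> real" and i
  assume *: "\<forall>t\<in>I. (\<Sum>j\<in>UNIV. c j *\<^sub>R column j (A t ** H)) = 0"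
  let ?c = "\<chi> j. c j"
  have "(\<Sum>k\<in>UNIV. (H *v ?c) $ k *\<^sub>R column k (A t)) = (\<Sum>j\<in>UNIV. c j *\<^sub>R column j (A t ** H))" for t
    unfolding column_matrix_mult
    by (simp add: matrix_vector_mult_def scaleR_sum_left scaleR_sum_right)
      (subst sum.swap, simp add: mult.commute)
  with * assms(2) have "H *v ?c = 0"
    by (simp add: columns_independent_on_def vec_eq_iff)
  then have "?c = 0"
    using assms(1) by (metis invertible_def matrix_vector_mul_assoc matrix_vector_mul_lid matrix_vector_mult_0_right)
  then show "c i = 0" by (simp add: vec_eq_iff)
qed

text \<open>A curve whose velocity is radial changes only its length.\<close>

lemma has_vector_derivative_direction:
  fixes X :: "real \<Rightarrow> 'a::real_inner"
  assumes X: "(X has_vector_derivative m *\<^sub>R X t) (at t)" and "X t \<noteq> 0"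
  shows "((\<lambda>s. inverse (norm (X s)) *\<^sub>R X s) has_vector_derivative 0) (at t)"
proof -
  have "((\<lambda>s. X s \<bullet> X s) has_vector_derivative X t \<bullet> m *\<^sub>R X t + m *\<^sub>R X t \<bullet> X t) (at t)"
    by (rule bounded_bilinear.has_vector_derivative[OF bounded_bilinear_inner X X])
  then have "((\<lambda>s. X s \<bullet> X s) has_real_derivative 2 * m * (norm (X t))\<^sup>2) (at t)"
    by (simp add: has_real_derivative_iff_has_vector_derivative power2_norm_eq_inner algebra_simps)
  then have "((\<lambda>s. sqrt (X s \<bullet> X s)) has_real_derivative
      inverse (sqrt (X t \<bullet> X t)) / 2 * (2 * m * (norm (X t))\<^sup>2)) (at t)"
    using \<open>X t \<noteq> 0\<close> by (intro DERIV_chain2[OF DERIV_real_sqrt]) simp_all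
  then have "((\<lambda>s. norm (X s)) has_real_derivative m * norm (X t)) (at t)"
    using \<open>X t \<noteq> 0\<close> by (simp add: norm_eq_sqrt_inner[symmetric] power2_eq_square field_simps)
  then have "((\<lambda>s. inverse (norm (X s))) has_real_derivative - (m / norm (X t))) (at t)"
    using DERIV_inverse'[of "\<lambda>s. norm (X s)"] \<open>X t \<noteq> 0\<close> by (fastforce simp: field_simps)
  from has_vector_derivative_scaleR[OF this X] \<open>X t \<noteq> 0\<close> show ?thesis
    by (simp add: field_simps)
qed

section \<open>Identities for the Gram matrix\<close>

text \<open>The hypotheses on \<open>A\<close> with the factor \<open>l\<close> made explicit.  As a locale they can be instantiated both for
the given matrix and for the normalized one.\<close>

locale reduced_time_component =
  fixes I :: "real set" and A :: "real \<Rightarrow> real^5^3" and l l' :: "real \<Rightarrow> real"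
  assumes I: "open I" "is_interval I" "I \<noteq> {}"
    and diff: "\<And>t. t \<in> I \<Longrightarrow> A differentiable (at t)"
    and det: "\<And>t. t \<in> I \<Longrightarrow> det3 (column 1 (A t)) (column 2 (A t)) (column 3 (A t)) = 1"
    and l_nz: "\<And>t. t \<in> I \<Longrightarrow> l t \<noteq> 0"
    and col2: "\<And>t. t \<in> I \<Longrightarrow> column 2 (A t) = l t *\<^sub>R column 4 (A t)"
    and col5: "\<And>t. t \<in> I \<Longrightarrow> column 5 (A t) = l t *\<^sub>R column 1 (A t)"
    and l': "\<And>t. t \<in> I \<Longrightarrow> (l has_real_derivative l' t) (at t)"
    and Q_const: "Q_constant_on I A"
    and indep: "columns_independent_on I A"
begin

abbreviation gram :: "5 \<Rightarrow> 5 \<Rightarrow> real \<Rightarrow> real" where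
  "gram i j t \<equiv> column i (A t) \<bullet> column j (A t)"

lemma det134: "t \<in> I \<Longrightarrow> l t * det3 (column 1 (A t)) (column 4 (A t)) (column 3 (A t)) = 1"
  using det[of t] by (simp add: col2 det3_linear)

lemma columns_nonzero:
  assumes "t \<in> I"
  shows "column 1 (A t) \<noteq> 0" "column 4 (A t) \<noteq> 0"
  using det134[OF assms] by (auto simp: det3_coords)

text \<open>Substituting \<open>A\<^sub>2 = l A\<^sub>4\<close> and \<open>A\<^sub>5 = l A\<^sub>1\<close> leaves only the brackets among \<open>A\<^sub>1, A\<^sub>4, A\<^sub>3\<close>.  In
\<open>Q\<^sub>2\<^sub>5\<close>, where both arguments carry the factor \<open>l\<close>, the two terms with \<open>l'\<close> cancel.\<close>

lemma Q_identities:
  assumes t: "t \<in> I"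
  shows "Q A 1 5 t = - (l' t * gram 1 1 t)"
    and "Q A 2 4 t = l' t * gram 4 4 t"
    and "Q A 1 2 t = l t * Q A 1 4 t - l' t * gram 1 4 t"
    and "Q A 2 5 t = - ((l t)\<^sup>2 * Q A 1 4 t)"
    and "Q A 3 5 t = - (l t * Q A 1 3 t) - l' t * gram 1 3 t"
    and "Q A 2 3 t = - (l t * Q A 3 4 t) + l' t * gram 4 3 t"
proof -
  let ?X = "\<lambda>j s. column j (A s)"
  have X: "?X j differentiable (at t)" for j
    using diff[OF t] by (rule differentiable_column)
  have b2: "bracket (?X 2) Y t = l t * bracket (?X 4) Y t + l' t * (?X 4 t \<bullet> Y t)" for Y
    using bracket_cong[OF I(1) t col2, where Y = Y and Y' = Y] bracket_scaleR_left[OF l'[OF t] X]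
    by simp
  have b5: "bracket (?X 5) Y t = l t * bracket (?X 1) Y t + l' t * (?X 1 t \<bullet> Y t)" for Y
    using bracket_cong[OF I(1) t col5, where Y = Y and Y' = Y] bracket_scaleR_left[OF l'[OF t] X]
    by simp
  have b2': "bracket Y (?X 2) t = l t * bracket Y (?X 4) t - l' t * (?X 4 t \<bullet> Y t)" for Y
    using b2[of Y] bracket_skew[of Y] by (simp add: algebra_simps)
  have b5': "bracket Y (?X 5) t = l t * bracket Y (?X 1) t - l' t * (?X 1 t \<bullet> Y t)" for Y
    using b5[of Y] bracket_skew[of Y] by (simp add: algebra_simps)
  have b31: "bracket (?X 3) (?X 1) t = - bracket (?X 1) (?X 3) t"
    and b43: "bracket (?X 4) (?X 3) t = - bracket (?X 3) (?X 4) t"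
    and b41: "bracket (?X 4) (?X 1) t = - bracket (?X 1) (?X 4) t"
    by (rule bracket_skew)+
  show "Q A 1 5 t = - (l' t * gram 1 1 t)"
    by (simp add: Q_eq_bracket b5' bracket_self)
  show "Q A 2 4 t = l' t * gram 4 4 t"
    by (simp add: Q_eq_bracket b2 bracket_self)
  show "Q A 1 2 t = l t * Q A 1 4 t - l' t * gram 1 4 t"
    by (simp add: Q_eq_bracket b2' inner_commute)
  show "Q A 2 5 t = - ((l t)\<^sup>2 * Q A 1 4 t)"
    by (simp add: Q_eq_bracket b2 b5' b41 col5[OF t] inner_commute power2_eq_square algebra_simps)
  show "Q A 3 5 t = - (l t * Q A 1 3 t) - l' t * gram 1 3 t"
    by (simp add: Q_eq_bracket b5' b31)
  show "Q A 2 3 t = - (l t * Q A 3 4 t) + l' t * gram 4 3 t"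
    by (simp add: Q_eq_bracket b2 b43)
qed

text \<open>Any point of the interval serves to evaluate these constants, see \<open>Q_eq_q\<close>.\<close>

definition q :: "5 \<Rightarrow> 5 \<Rightarrow> real" where
  "q i j = Q A i j (SOME t. t \<in> I)"

lemma Q_eq_q: "t \<in> I \<Longrightarrow> Q A i j t = q i j"
proof -
  obtain c where "\<forall>t\<in>I. Q A i j t = c"
    using Q_const unfolding Q_constant_on_iff constant_on_def by blast
  moreover have "(SOME t. t \<in> I) \<in> I"
    using I(3) by (simp add: some_in_eq)
  ultimately show "t \<in> I \<Longrightarrow> Q A i j t = q i j" by (simp add: q_def)
qed

lemma l'_gram11: "t \<in> I \<Longrightarrow> l' t * gram 1 1 t = - q 1 5"
  using Q_identities(1) Q_eq_q by force

text \<open>This is where the independence of the columns enters: if \<open>Q\<^sub>1\<^sub>5 = 0\<close>, then \<open>l\<close> is a constant \<open>k\<close> and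
\<open>A\<^sub>5 - k A\<^sub>1\<close> vanishes on the whole interval.\<close>

lemma q15_nonzero: "q 1 5 \<noteq> 0"
proof
  assume "q 1 5 = 0"
  then have "(l has_vector_derivative 0) (at t within I)" if "t \<in> I" for t
    using l'_gram11[OF that] columns_nonzero[OF that] l'[OF that]
    by (simp add: has_real_derivative_iff_has_vector_derivative has_vector_derivative_at_within)
  then obtain k where k: "\<And>t. t \<in> I \<Longrightarrow> l t = k"
    using has_vector_derivative_zero_constant is_interval_convex I(2) by metis
  let ?c = "\<lambda>i::5. if i = 5 then 1 else if i = 1 then - k else 0"
  have "\<forall>t\<in>I. (\<Sum>i\<in>UNIV. ?c i *\<^sub>R column i (A t)) = 0"
    unfolding sum_5 by (simp add: col5 k)
  then have "?c 5 = 0"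
    using indep[unfolded columns_independent_on_def, THEN spec, of ?c] by blast
  then show False by simp
qed

lemma l'_nonzero: "t \<in> I \<Longrightarrow> l' t \<noteq> 0"
  using l'_gram11 q15_nonzero by force

text \<open>Differentiating \<open>Q\<^sub>2\<^sub>5 = - l\<^sup>2 Q\<^sub>1\<^sub>4\<close>, both of whose brackets are constant, gives
\<open>l l' Q\<^sub>1\<^sub>4 = 0\<close>.\<close>

lemma q14_zero: "q 1 4 = 0"
proof -
  obtain t where t: "t \<in> I" using I by blast
  have "((\<lambda>s. - ((l s)\<^sup>2 * q 1 4)) has_real_derivative - (2 * l t * l' t * q 1 4)) (at t)"
    using l'[OF t] by (auto intro!: derivative_eq_intros)
  moreover have "((\<lambda>s. - ((l s)\<^sup>2 * q 1 4)) has_real_derivative 0) (at t)"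
    by (rule has_field_derivative_transform_within_open[OF DERIV_const[of "q 2 5"] I(1) t])
      (use Q_identities(4) Q_eq_q in force)
  ultimately have "- (2 * l t * l' t * q 1 4) = 0"
    by (rule DERIV_unique)
  with t show ?thesis by (simp add: l_nz l'_nonzero)
qed

text \<open>With \<open>Q\<^sub>1\<^sub>4 = 0\<close> the identities express \<open>l'\<close> times the Gram matrix through constants and \<open>l\<close>.  The
\<open>l\<close>-dependence of the last two is harmless, because \<open>l\<close> times \<open>A\<^sub>1\<close> or \<open>A\<^sub>4\<close> is again a column.\<close>

lemma gram_identities:
  assumes "t \<in> I"
  shows "l' t * gram 4 4 t = q 2 4" "l' t * gram 1 4 t = - q 1 2"
    "l' t * gram 1 3 t = - q 3 5 - l t * q 1 3" "l' t * gram 4 3 t = q 2 3 + l t * q 3 4"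
  using Q_identities[OF assms] Q_eq_q[OF assms] q14_zero by auto

text \<open>The derivative of \<open>l\<close> has no zero, so \<open>l\<close> cannot enter an affine relation with constant
coefficients.\<close>

lemma coefficient_of_l_zero:
  assumes "\<And>t. t \<in> I \<Longrightarrow> l t * c = d"
  shows "c = 0"
proof -
  obtain t where t: "t \<in> I" using I by blast
  have "((\<lambda>s. l s * c) has_real_derivative l' t * c) (at t)"
    using l'[OF t] by (auto intro!: derivative_eq_intros)
  moreover have "((\<lambda>s. l s * c) has_real_derivative 0) (at t)"
    by (rule has_field_derivative_transform_within_open[OF DERIV_const[of d] I(1) t]) (use assms in simp)
  ultimately have "l' t * c = 0"
    by (rule DERIV_unique)
  with t show ?thesis by (simp add: l'_nonzero)
qed

lemma after_admissible_change:
  assumes cr: "c \<noteq> 0" "r \<noteq> 0"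
  shows "reduced_time_component I (\<lambda>t. A t ** admissible_change c r \<kappa> x1 x2 x4 x5)
    (\<lambda>t. l t / c) (\<lambda>t. l' t / c)"
proof
  let ?H = "admissible_change c r \<kappa> x1 x2 x4 x5"
  show "(\<lambda>t. A t ** ?H) differentiable (at t)" if "t \<in> I" for t
    using diff[OF that] bounded_linear.has_derivative[OF bounded_linear_matrix_mult_right]
    unfolding differentiable_def by blast
  show "det3 (column 1 (A t ** ?H)) (column 2 (A t ** ?H)) (column 3 (A t ** ?H)) = 1" if "t \<in> I" for t
    using det[OF that] col2[OF that] col5[OF that] cr
    by (simp add: columns_admissible_change det3_linear det3_repeated algebra_simps divide_simps)
  show "((\<lambda>t. l t / c) has_real_derivative l' t / c) (at t)" if "t \<in> I" for t
    using l'[OF that] by (rule DERIV_cdivide)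
  show "column 2 (A t ** ?H) = (l t / c) *\<^sub>R column 4 (A t ** ?H)"
    "column 5 (A t ** ?H) = (l t / c) *\<^sub>R column 1 (A t ** ?H)" if "t \<in> I" for t
    using that by (simp_all add: columns_admissible_change col2 col5 scaleR_diff_right algebra_simps)
  show "Q_constant_on I (\<lambda>t. A t ** ?H)"
    by (rule Q_constant_on_matrix_mult[OF diff Q_const])
  show "columns_independent_on I (\<lambda>t. A t ** ?H)"
    by (rule columns_independent_on_matrix_mult[OF admissible_change_inverse(1)[OF cr] indep])
qed (use I l_nz cr in auto)

end

section \<open>Gram--Schmidt with constant coefficients\<close>

locale normalized_time_component = reduced_time_component +
  assumes orth14: "\<And>t. t \<in> I \<Longrightarrow> gram 1 4 t = 0"
    and orth13: "\<And>t. t \<in> I \<Longrightarrow> gram 1 3 t = 0"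
    and orth43: "\<And>t. t \<in> I \<Longrightarrow> gram 4 3 t = 0"
    and equal_length: "\<And>t. t \<in> I \<Longrightarrow> gram 4 4 t = gram 1 1 t"
    and speed: "\<And>t. t \<in> I \<Longrightarrow> l' t * gram 1 1 t = - 1"

text \<open>Dividing \<open>gram_identities\<close> by \<open>l' \<langle>A\<^sub>1, A\<^sub>1\<rangle> = - c\<close> gives the ratios
\<open>\<langle>A\<^sub>1, A\<^sub>4\<rangle> = \<kappa> \<langle>A\<^sub>1, A\<^sub>1\<rangle>\<close> and \<open>\<langle>A\<^sub>4, A\<^sub>4\<rangle> = (d + \<kappa>\<^sup>2) \<langle>A\<^sub>1, A\<^sub>1\<rangle>\<close> with constants, where \<open>d > 0\<close>
is the strict Cauchy--Schwarz inequality for the independent vectors \<open>A\<^sub>1, A\<^sub>4\<close>.\<close>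

lemma (in reduced_time_component) normalizing_change:
  obtains c r \<kappa> x1 x2 x4 x5 where "c \<noteq> 0" "r \<noteq> 0"
    "normalized_time_component I (\<lambda>t. A t ** admissible_change c r \<kappa> x1 x2 x4 x5)
      (\<lambda>t. l t / c) (\<lambda>t. l' t / c)"
proof -
  define c \<kappa> d where "c = q 1 5" and "\<kappa> = q 1 2 / q 1 5" and "d = - (q 2 4 / q 1 5) - \<kappa>\<^sup>2"
  define r where "r = sqrt d"
  have c: "c \<noteq> 0" by (simp add: c_def q15_nonzero)
  have m14: "gram 1 4 t = \<kappa> * gram 1 1 t" and m44: "gram 4 4 t = (d + \<kappa>\<^sup>2) * gram 1 1 t"
    and m13: "gram 1 3 t = gram 1 1 t * (q 3 5 + l t * q 1 3) / c"
    and m43: "gram 4 3 t = - (gram 1 1 t * (q 2 3 + l t * q 3 4) / c)"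
    if t: "t \<in> I" for t
  proof -
    have eq: "gram 1 1 t = - c / l' t" "gram 1 4 t = - q 1 2 / l' t" "gram 4 4 t = q 2 4 / l' t"
      "gram 1 3 t = (- q 3 5 - l t * q 1 3) / l' t" "gram 4 3 t = (q 2 3 + l t * q 3 4) / l' t"
      using l'_gram11[OF t] gram_identities[OF t] l'_nonzero[OF t]
      by (simp_all add: c_def field_simps)
    show "gram 1 4 t = \<kappa> * gram 1 1 t" "gram 4 4 t = (d + \<kappa>\<^sup>2) * gram 1 1 t"
      "gram 1 3 t = gram 1 1 t * (q 3 5 + l t * q 1 3) / c"
      "gram 4 3 t = - (gram 1 1 t * (q 2 3 + l t * q 3 4) / c)"
      unfolding eq using l'_nonzero[OF t] q15_nonzero
      by (simp_all add: c_def \<kappa>_def d_def field_simps)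
  qed
  have sheared: "(column 4 (A t) - \<kappa> *\<^sub>R column 1 (A t)) \<bullet> (column 4 (A t) - \<kappa> *\<^sub>R column 1 (A t))
      = d * gram 1 1 t" if "t \<in> I" for t
    using m14[OF that] m44[OF that]
    by (simp add: inner_diff_left inner_diff_right inner_commute power2_eq_square algebra_simps)
  have d: "d > 0"
  proof -
    obtain t where t: "t \<in> I" using I by blast
    have "column 4 (A t) - \<kappa> *\<^sub>R column 1 (A t) \<noteq> 0"
    proof
      assume "column 4 (A t) - \<kappa> *\<^sub>R column 1 (A t) = 0"
      then have "column 4 (A t) = \<kappa> *\<^sub>R column 1 (A t)" by simp
      with det134[OF t] show False by (simp add: det3_linear det3_repeated)
    qed
    then have "d * gram 1 1 t > 0"
      using sheared[OF t] by (metis inner_gt_zero_iff)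
    moreover have "gram 1 1 t > 0"
      using columns_nonzero[OF t] by simp
    ultimately show ?thesis by (simp add: zero_less_mult_iff)
  qed
  then have r: "r > 0" "r * r = d" by (simp_all add: r_def)
  \<comment> \<open>These are the solutions of the linear equations that say that the coefficients of 1 and of
    \<open>l\<close> vanish in the inner products of the new third column with \<open>A\<^sub>1\<close> and with \<open>A\<^sub>4\<close>.\<close>
  define x4 where "x4 = (r / d) * (q 2 3 + \<kappa> * q 3 5)"
  define x1 where "x1 = - r * q 3 5 - \<kappa> * x4"
  define x2 where "x2 = (r / d) * (q 3 4 + \<kappa> * q 1 3)"
  define x5 where "x5 = - r * q 1 3 - \<kappa> * x2"
  let ?B = "\<lambda>t. A t ** admissible_change c r \<kappa> x1 x2 x4 x5"
  interpret B: reduced_time_component I ?B "\<lambda>t. l t / c" "\<lambda>t. l' t / c"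
    using c r by (intro after_admissible_change) auto
  have e1: "x1 + \<kappa> * x4 = - r * q 3 5" and e5: "x5 + \<kappa> * x2 = - r * q 1 3"
    by (simp_all add: x1_def x5_def)
  have f4: "d * x4 = r * (q 2 3 + \<kappa> * q 3 5)" and f2: "d * x2 = r * (q 3 4 + \<kappa> * q 1 3)"
    using d by (simp_all add: x4_def x2_def)
  have o13: "B.gram 1 3 t = 0" if t: "t \<in> I" for t
  proof -
    have "B.gram 1 3 t = c * r * gram 1 3 t + (x1 + l t * x5) * gram 1 1 t + (l t * x2 + x4) * gram 1 4 t"
      by (simp add: columns_admissible_change col2[OF t] col5[OF t] inner_add_right algebra_simps)
    also have "\<dots> = gram 1 1 t * ((x1 + \<kappa> * x4 + r * q 3 5) + l t * (x5 + \<kappa> * x2 + r * q 1 3))"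
      using c by (simp add: m13[OF t] m14[OF t] field_simps)
    finally show ?thesis by (simp add: e1 e5)
  qed
  have o43': "column 4 (A t) \<bullet> column 3 (?B t) = 0" if t: "t \<in> I" for t
  proof -
    have "column 4 (A t) \<bullet> column 3 (?B t) = c * r * gram 4 3 t + (x1 + l t * x5) * gram 1 4 t + (l t * x2 + x4) * gram 4 4 t"
      by (simp add: columns_admissible_change col2[OF t] col5[OF t] inner_add_right inner_commute algebra_simps)
    also have "\<dots> = gram 1 1 t * (\<kappa> * (x1 + \<kappa> * x4) + d * x4 - r * q 2 3
        + l t * (\<kappa> * (x5 + \<kappa> * x2) + d * x2 - r * q 3 4))"
      using c by (simp add: m43[OF t] m14[OF t] m44[OF t] power2_eq_square field_simps)
    finally show ?thesis unfolding e1 e5 f4 f2 by (simp add: algebra_simps)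
  qed
  have "normalized_time_component I ?B (\<lambda>t. l t / c) (\<lambda>t. l' t / c)"
  proof
    fix t assume t: "t \<in> I"
    show "B.gram 1 3 t = 0" by (rule o13[OF t])
    have "B.gram 4 3 t = (column 4 (A t) \<bullet> column 3 (?B t) - \<kappa> * B.gram 1 3 t) / r"
      by (simp add: columns_admissible_change(1,4) inner_diff_left diff_divide_distrib)
    then show "B.gram 4 3 t = 0" by (simp add: o43'[OF t] o13[OF t])
    show "B.gram 1 4 t = 0"
      by (simp add: columns_admissible_change m14[OF t] inner_diff_right)
    show "B.gram 4 4 t = B.gram 1 1 t"
      using r d by (simp add: columns_admissible_change sheared[OF t])
    show "l' t / c * B.gram 1 1 t = - 1"
      using l'_gram11[OF t] c by (simp add: columns_admissible_change c_def field_simps)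
  qed
  then show thesis
    using c r by (intro that) auto
qed

section \<open>The frame of a normalized solution is constant\<close>

text \<open>The velocity of \<open>X\<close> is orthogonal to \<open>Y\<close> and \<open>Z\<close>, as \<open>X\<close> itself is; since \<open>X, Y, Z\<close> is a basis, the
velocity is a multiple of \<open>X\<close>.\<close>

lemma constant_direction:
  fixes X :: "real \<Rightarrow> real^3"
  assumes I: "open I" "is_interval I"
    and diff: "\<And>t. t \<in> I \<Longrightarrow> X differentiable (at t)"
    and basis: "\<And>t. t \<in> I \<Longrightarrow> det3 (X t) (Y t) (Z t) \<noteq> 0"
    and orth: "\<And>t. t \<in> I \<Longrightarrow> X t \<bullet> Y t = 0" "\<And>t. t \<in> I \<Longrightarrow> X t \<bullet> Z t = 0"
    and orth': "\<And>t. t \<in> I \<Longrightarrow> vector_derivative X (at t) \<bullet> Y t = 0"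
       "\<And>t. t \<in> I \<Longrightarrow> vector_derivative X (at t) \<bullet> Z t = 0"
  obtains e where "\<And>t. t \<in> I \<Longrightarrow> inverse (norm (X t)) *\<^sub>R X t = e"
proof -
  have "((\<lambda>s. inverse (norm (X s)) *\<^sub>R X s) has_vector_derivative 0) (at t within I)" if t: "t \<in> I" for t
  proof -
    let ?D = "vector_derivative X (at t)" and ?n = "X t \<bullet> X t"
    have nz: "X t \<noteq> 0" using basis[OF t] by (auto simp: det3_eq_triple_product)
    have "?D - (?D \<bullet> X t / ?n) *\<^sub>R X t = 0"
      by (rule eq_zero_if_orthogonal_to_basis[OF basis[OF t]])
        (use nz orth[OF t] orth'[OF t] in \<open>simp_all add: inner_diff_left\<close>)
    then have "?D = (?D \<bullet> X t / ?n) *\<^sub>R X t" by simp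
    moreover have "(X has_vector_derivative ?D) (at t)"
      using diff[OF t] by (simp add: vector_derivative_works)
    ultimately have "(X has_vector_derivative (?D \<bullet> X t / ?n) *\<^sub>R X t) (at t)"
      by metis
    from has_vector_derivative_direction[OF this nz] show ?thesis
      by (rule has_vector_derivative_at_within)
  qed
  then show thesis
    using that by (rule has_vector_derivative_zero_constant[OF is_interval_convex[OF I(2)]])
qed

lemma inner_derivatives_orthogonal:
  fixes X Y :: "real \<Rightarrow> 'a::real_inner"
  assumes "open I" "t \<in> I" "X differentiable (at t)" "Y differentiable (at t)"
    and "\<And>s. s \<in> I \<Longrightarrow> X s \<bullet> Y s = 0"
  shows "vector_derivative X (at t) \<bullet> Y t + vector_derivative Y (at t) \<bullet> X t = 0"
proof -
  have "((\<lambda>s. X s \<bullet> Y s) has_vector_derivative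
      X t \<bullet> vector_derivative Y (at t) + vector_derivative X (at t) \<bullet> Y t) (at t)"
    using assms(3,4)
    by (intro bounded_bilinear.has_vector_derivative[OF bounded_bilinear_inner])
      (simp_all add: vector_derivative_works)
  moreover have "((\<lambda>s. X s \<bullet> Y s) has_vector_derivative 0) (at t)"
    by (rule has_vector_derivative_transform_within_open[OF has_vector_derivative_const assms(1,2)])
      (simp add: assms(5))
  ultimately have "X t \<bullet> vector_derivative Y (at t) + vector_derivative X (at t) \<bullet> Y t = 0"
    by (rule vector_derivative_unique_at)
  then show ?thesis by (simp add: inner_commute)
qed

lemma columns_orthonormal_imp_rotation_matrix:
  fixes e1 e2 :: "real^3"
  assumes "e1 \<bullet> e1 = 1" "e2 \<bullet> e2 = 1" "e1 \<bullet> e2 = 0"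
  shows "rotation_matrix (transpose (vector [e1, e2, cross3 e1 e2]))"
proof -
  have "norm e1 = 1" "norm e2 = 1" using assms by (simp_all add: norm_eq_1)
  then have n: "cross3 e1 e2 \<bullet> cross3 e1 e2 = 1"
    using norm_cross_dot[of e1 e2] assms(3) by (simp add: power2_norm_eq_inner)
  have "det3 e1 e2 (cross3 e1 e2) = cross3 e1 e2 \<bullet> cross3 e1 e2"
    by (simp add: det3_coords algebra_simps)
  with n have "det (transpose (vector [e1, e2, cross3 e1 e2]) :: real^3^3) = 1"
    by (simp add: det3_def)
  moreover have "orthogonal_matrix (transpose (vector [e1, e2, cross3 e1 e2]) :: real^3^3)"
  proof -
    let ?M = "vector [e1, e2, cross3 e1 e2] :: real^3^3"
    have "(?M ** transpose ?M) $ i $ j = ?M $ i \<bullet> ?M $ j" for i j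
      by (simp add: matrix_matrix_mult_def transpose_def inner_vec_def)
    then have "?M ** transpose ?M = mat 1"
      unfolding vec_eq_iff forall_3
      using assms n by (simp add: mat_def dot_cross_self inner_commute[of e2 e1])
    then show ?thesis by (simp add: orthogonal_matrix)
  qed
  ultimately show ?thesis by (simp add: rotation_matrix_def)
qed

lemma column_of_columns:
  "column 1 (transpose (vector [x, y, z] :: real^3^3)) = x"
  "column 2 (transpose (vector [x, y, z] :: real^3^3)) = y"
  "column 3 (transpose (vector [x, y, z] :: real^3^3)) = z"
  by (simp_all add: column_def transpose_def vec_eq_iff)

lemma columns_mult_B_matrix:
  "column 1 (R ** B_matrix b11 0 0 b22 0 l) = b11 *\<^sub>R column 1 R"
  "column 2 (R ** B_matrix b11 0 0 b22 0 l) = b22 *\<^sub>R column 2 R"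
  "column 3 (R ** B_matrix b11 0 0 b22 0 l) = (1 / (b11 * b22)) *\<^sub>R column 3 R"
  "column 4 (R ** B_matrix b11 0 0 b22 0 l) = (b22 / l) *\<^sub>R column 2 R"
  "column 5 (R ** B_matrix b11 0 0 b22 0 l) = (l * b11) *\<^sub>R column 1 R"
  by (simp_all add: column_matrix_mult B_matrix_def sum_3 vector_5)

text \<open>The bracket is the difference of \<open>\<langle>X', Y\<rangle>\<close> and \<open>\<langle>Y', X\<rangle>\<close>, and the derivative of \<open>\<langle>X, Y\<rangle>\<close> is their
sum.  When both vanish, so do the two terms.\<close>

lemma (in reduced_time_component) derivative_orthogonal:
  assumes t: "t \<in> I" and "q i j = 0" and "\<And>s. s \<in> I \<Longrightarrow> gram i j s = 0"
  shows "vector_derivative (\<lambda>s. column i (A s)) (at t) \<bullet> column j (A t) = 0"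
proof -
  have "vector_derivative (\<lambda>s. column i (A s)) (at t) \<bullet> column j (A t)
      - vector_derivative (\<lambda>s. column j (A s)) (at t) \<bullet> column i (A t) = 0"
    using Q_eq_q[OF t, of i j] assms(2) by (simp add: Q_def)
  moreover have "vector_derivative (\<lambda>s. column i (A s)) (at t) \<bullet> column j (A t)
      + vector_derivative (\<lambda>s. column j (A s)) (at t) \<bullet> column i (A t) = 0"
    by (rule inner_derivatives_orthogonal[OF I(1) t]) (use diff[OF t] assms(3) differentiable_column in auto)
  ultimately show ?thesis by simp
qed

text \<open>The entries \<open>b\<^sub>1\<^sub>1\<close> and \<open>l\<close> have to be smooth, which is not evident from norms and quotients.  Since the
frame \<open>e\<^sub>1, e\<^sub>2, e\<^sub>3\<close> is constant, the coordinates of the columns in it are linear in \<open>A\<close>;  \<open>b\<^sub>1\<^sub>1\<close> is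
such a coordinate, and \<open>l\<close> is the product of \<open>l b\<^sub>1\<^sub>1\<close>, \<open>b\<^sub>2\<^sub>2\<close> and \<open>1 / (b\<^sub>1\<^sub>1 b\<^sub>2\<^sub>2)\<close>, which
are coordinates too.\<close>

lemma (in normalized_time_component) normal_form:
  assumes smooth: "smooth_on I A"
  shows "\<exists>R w b11 b12 b13 b22 b23 l. is_normal_form_on I A R w b11 b12 b13 b22 b23 l \<and> R constant_on I"
proof -
  let ?X = "\<lambda>j t. column j (A t)"
  \<comment> \<open>Orthogonality to the third column turns \<open>gram_identities\<close> into \<open>l Q\<^sub>1\<^sub>3 = - Q\<^sub>3\<^sub>5\<close> and
    \<open>l Q\<^sub>3\<^sub>4 = - Q\<^sub>2\<^sub>3\<close>.\<close>
  have q13: "q 1 3 = 0"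
    by (rule coefficient_of_l_zero[of _ "- q 3 5"]) (use gram_identities(3) orth13 in force)
  have q34: "q 3 4 = 0"
    by (rule coefficient_of_l_zero[of _ "- q 2 3"]) (use gram_identities(4) orth43 in force)
  have sym: "q j i = - q i j" for i j
    unfolding q_def Q_eq_bracket by (rule bracket_skew)
  have q41: "q 4 1 = 0" and q43: "q 4 3 = 0"
    using sym[of 1 4] sym[of 3 4] q14_zero q34 by simp_all
  have basis: "det3 (?X 1 t) (?X 4 t) (?X 3 t) \<noteq> 0" "det3 (?X 4 t) (?X 1 t) (?X 3 t) \<noteq> 0" if "t \<in> I" for t
  proof -
    show "det3 (?X 1 t) (?X 4 t) (?X 3 t) \<noteq> 0" using det134[OF that] by auto
    moreover have "det3 (?X 4 t) (?X 1 t) (?X 3 t) = - det3 (?X 1 t) (?X 4 t) (?X 3 t)"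
      by (simp add: det3_coords algebra_simps)
    ultimately show "det3 (?X 4 t) (?X 1 t) (?X 3 t) \<noteq> 0" by simp
  qed
  have diffX: "?X j differentiable (at t)" if "t \<in> I" for j t
    using diff[OF that] by (rule differentiable_column)
  have orth41: "gram 4 1 t = 0" if "t \<in> I" for t using orth14[OF that] by (simp add: inner_commute)
  have "\<exists>e1. \<forall>t\<in>I. inverse (norm (?X 1 t)) *\<^sub>R ?X 1 t = e1"
    by (rule constant_direction[OF I(1,2) diffX basis(1) orth14 orth13
          derivative_orthogonal[OF _ q14_zero orth14] derivative_orthogonal[OF _ q13 orth13]]) blast+
  then obtain e1 where e1: "\<And>t. t \<in> I \<Longrightarrow> inverse (norm (?X 1 t)) *\<^sub>R ?X 1 t = e1"
    by blast
  have "\<exists>e2. \<forall>t\<in>I. inverse (norm (?X 4 t)) *\<^sub>R ?X 4 t = e2"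
    by (rule constant_direction[OF I(1,2) diffX basis(2) orth41 orth43
          derivative_orthogonal[OF _ q41 orth41] derivative_orthogonal[OF _ q43 orth43]]) blast+
  then obtain e2 where e2: "\<And>t. t \<in> I \<Longrightarrow> inverse (norm (?X 4 t)) *\<^sub>R ?X 4 t = e2"
    by blast
  define e3 where "e3 = cross3 e1 e2"
  define a where "a t = ?X 1 t \<bullet> e1" for t
  define L where "L t = (?X 5 t \<bullet> e1) * ((?X 2 t \<bullet> e2) * (?X 3 t \<bullet> e3))" for t
  obtain t0 where t0: "t0 \<in> I" using I by blast
  have e: "e1 \<bullet> e1 = 1" "e2 \<bullet> e2 = 1" "e1 \<bullet> e2 = 0"
    using columns_nonzero[OF t0] orth14[OF t0]
    by (simp_all flip: e1[OF t0] e2[OF t0] add: dot_square_norm power2_eq_square)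
  have rot: "rotation_matrix (transpose (vector [e1, e2, e3]))"
    unfolding e3_def using e by (rule columns_orthonormal_imp_rotation_matrix)
  then have det_e: "det3 e1 e2 e3 = 1" by (simp add: det3_def rotation_matrix_def)
  have e': "e3 \<bullet> e1 = 0" "e3 \<bullet> e2 = 0" "e1 \<bullet> e3 = 0" "e2 \<bullet> e3 = 0"
    by (simp_all add: e3_def dot_cross_self)
  have e33: "e3 \<bullet> e3 = 1"
    using det_e unfolding e3_def by (simp add: det3_coords algebra_simps)
  have X1: "?X 1 t = a t *\<^sub>R e1" and X4: "?X 4 t = a t *\<^sub>R e2" and a_pos: "a t > 0"
    if t: "t \<in> I" for t
  proof -
    have 1: "?X 1 t = norm (?X 1 t) *\<^sub>R e1" and 4: "?X 4 t = norm (?X 4 t) *\<^sub>R e2"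
      using columns_nonzero[OF t] by (simp_all flip: e1[OF t] e2[OF t])
    have n1: "norm (?X 1 t) = a t" unfolding a_def by (subst (2) 1) (simp add: e)
    have n4: "norm (?X 4 t) = a t"
      using equal_length[OF t] by (simp add: norm_eq flip: n1)
    show "?X 1 t = a t *\<^sub>R e1" "?X 4 t = a t *\<^sub>R e2"
      using 1 4 unfolding n1 n4 .
    show "a t > 0"
      using columns_nonzero[OF t] by (simp flip: n1)
  qed
  have X3: "?X 3 t = (1 / (a t * (l t * a t))) *\<^sub>R e3" if t: "t \<in> I" for t
  proof -
    define h where "h = ?X 3 t \<bullet> e3"
    have "?X 3 t - h *\<^sub>R e3 = 0"
    proof (rule eq_zero_if_orthogonal_to_basis)
      show "det3 e1 e2 e3 \<noteq> 0" using det_e by simp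
      show "(?X 3 t - h *\<^sub>R e3) \<bullet> e1 = 0" "(?X 3 t - h *\<^sub>R e3) \<bullet> e2 = 0"
        using orth13[OF t] orth43[OF t] a_pos[OF t]
        by (simp_all add: X1[OF t] X4[OF t] inner_diff_left e' inner_commute[of _ e1] inner_commute[of _ e2] inner_diff_right)
      show "(?X 3 t - h *\<^sub>R e3) \<bullet> e3 = 0"
        by (simp add: inner_diff_left e33 h_def)
    qed
    then have 3: "?X 3 t = h *\<^sub>R e3" by simp
    have "l t * (a t * (a t * h)) = 1"
      using det134[OF t] by (simp add: X1[OF t] X4[OF t] 3 det3_linear det_e mult_ac)
    then have "h = 1 / (a t * (l t * a t))"
      using a_pos[OF t] l_nz[OF t] by (simp add: field_simps)
    with 3 show ?thesis by simp
  qed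
  have L: "L t = l t" if t: "t \<in> I" for t
    using a_pos[OF t] l_nz[OF t]
    by (simp add: L_def col2[OF t] col5[OF t] X1[OF t] X4[OF t] X3[OF t] e e33)
  have smooth_coord: "smooth_on I (\<lambda>t. ?X j t \<bullet> u)" for j u
    by (rule smooth_on_linear[OF I(1) _ smooth])
      (rule bounded_linear_compose[OF bounded_linear_inner_left bounded_linear_column])
  have "is_normal_form_on I A (\<lambda>_. transpose (vector [e1, e2, e3])) (\<lambda>_. 0) a (\<lambda>_. 0) (\<lambda>_. 0)
      (\<lambda>t. L t * a t) (\<lambda>_. 0) L"
    unfolding is_normal_form_on_def
  proof (intro conjI ballI)
    show "smooth_on I a" unfolding a_def by (rule smooth_coord)
    show "smooth_on I L" unfolding L_def by (intro smooth_on_mult I(1) smooth_coord)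
  next
    fix t assume t: "t \<in> I"
    show "A t = transpose (vector [e1, e2, e3]) ** B_matrix (a t) 0 0 (L t * a t) 0 (L t)"
    proof (rule matrix_eqI_columns)
      fix j
      have "\<forall>j. column j (A t) = column j (transpose (vector [e1, e2, e3]) ** B_matrix (a t) 0 0 (L t * a t) 0 (L t))"
        unfolding forall_5 columns_mult_B_matrix column_of_columns
        using l_nz[OF t] by (simp add: L[OF t] col2[OF t] col5[OF t] X1[OF t] X4[OF t] X3[OF t])
      then show "column j (A t) = column j (transpose (vector [e1, e2, e3]) ** B_matrix (a t) 0 0 (L t * a t) 0 (L t))" ..
    qed
    have "l' t = - 1 / (a t)\<^sup>2"
      using speed[OF t] a_pos[OF t] by (simp add: X1[OF t] e power2_eq_square field_simps)
    with l'[OF t] have "(l has_real_derivative - 1 / (a t)\<^sup>2) (at t)" by simp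
    then show "(L has_real_derivative - 1 / (a t)\<^sup>2) (at t)"
      by (rule has_field_derivative_transform_within_open[OF _ I(1) t]) (simp add: L)
    show "a t \<noteq> 0" "L t \<noteq> 0" using a_pos[OF t] l_nz[OF t] L[OF t] by auto
  qed (auto simp: smooth_on_const rot is_rotation_vector_def)
  then show ?thesis by (force simp: constant_on_def)
qed

lemma normal_form_exists:
  fixes I :: "real set"
  assumes I: "open I" "is_interval I" "I \<noteq> {}"
    and A: "smooth_on I A" "columns_independent_on I A" "\<And>t. t \<in> I \<Longrightarrow> det_conditions (A t)"
      "Q_constant_on I A"
  shows "\<exists>H. invertible H \<and> preserves_spatial_constraints H \<and> preserves_det_conditions H \<and>
     (\<exists>R w b11 b12 b13 b22 b23 l.
        is_normal_form_on I (\<lambda>t. A t ** H) R w b11 b12 b13 b22 b23 l \<and> R constant_on I)"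
proof -
  have diff: "A differentiable (at t)" if "t \<in> I" for t
    using smooth_on_imp_differentiable[OF A(1) that] .
  \<comment> \<open>The factor of \<open>det_conditions_iff\<close> as a quotient of inner products, which makes its
    differentiability evident.\<close>
  define l where "l t = column 5 (A t) \<bullet> column 1 (A t) / (column 1 (A t) \<bullet> column 1 (A t))" for t
  have cols: "det3 (column 1 (A t)) (column 2 (A t)) (column 3 (A t)) = 1 \<and> l t \<noteq> 0 \<and>
      column 2 (A t) = l t *\<^sub>R column 4 (A t) \<and> column 5 (A t) = l t *\<^sub>R column 1 (A t)" if t: "t \<in> I" for t
  proof -
    obtain m where m: "det3 (column 1 (A t)) (column 2 (A t)) (column 3 (A t)) = 1" "m \<noteq> 0"
      "column 2 (A t) = m *\<^sub>R column 4 (A t)" "column 5 (A t) = m *\<^sub>R column 1 (A t)"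
      using A(3)[OF t] by (auto simp: det_conditions_iff)
    then have "column 1 (A t) \<noteq> 0" by (auto simp: det3_eq_triple_product)
    with m(4) have "l t = m" by (simp add: l_def)
    with m show ?thesis by simp
  qed
  have "\<exists>D. (l has_real_derivative D) (at t)" if "t \<in> I" for t
  proof -
    have "column 1 (A t) \<noteq> 0" using cols[OF that] by (auto simp: det3_eq_triple_product)
    then have "l differentiable (at t)"
      unfolding l_def using differentiable_column[OF diff[OF that]]
      by (intro differentiable_divide differentiable_inner) auto
    then show ?thesis by (simp add: real_differentiable_def)
  qed
  then obtain l' where l': "\<And>t. t \<in> I \<Longrightarrow> (l has_real_derivative l' t) (at t)" by metis
  have cols': "t \<in> I \<Longrightarrow> det3 (column 1 (A t)) (column 2 (A t)) (column 3 (A t)) = 1"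
    "t \<in> I \<Longrightarrow> l t \<noteq> 0" "t \<in> I \<Longrightarrow> column 2 (A t) = l t *\<^sub>R column 4 (A t)"
    "t \<in> I \<Longrightarrow> column 5 (A t) = l t *\<^sub>R column 1 (A t)" for t
    using cols[of t] by blast+
  interpret reduced_time_component I A l l'
    by unfold_locales (rule I A(2,4) | erule diff cols' l')+
  obtain c r \<kappa> x1 x2 x4 x5 where cr: "c \<noteq> 0" "r \<noteq> 0" and
    B: "normalized_time_component I (\<lambda>t. A t ** admissible_change c r \<kappa> x1 x2 x4 x5)
      (\<lambda>t. l t / c) (\<lambda>t. l' t / c)"
    by (rule normalizing_change)
  have "smooth_on I (\<lambda>t. A t ** admissible_change c r \<kappa> x1 x2 x4 x5)"
    by (rule smooth_on_linear[OF I(1) bounded_linear_matrix_mult_right A(1)])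
  from normalized_time_component.normal_form[OF B this] show ?thesis
    by (intro exI[of _ "admissible_change c r \<kappa> x1 x2 x4 x5"] conjI
        admissible_change_inverse(1)[OF cr] preserves_spatial_constraints_admissible_change[OF cr]
        preserves_det_conditions_admissible_change[OF cr])
qed

section \<open>Normal forms satisfy all conditions\<close>

text \<open>From \<open>w = 0\<close> and the orthogonality of \<open>R\<close> one gets \<open>R' = 0\<close>.  With a constant frame, the columns
\<open>A\<^sub>1, A\<^sub>5\<close> lie along \<open>e\<^sub>1\<close>, the columns \<open>A\<^sub>2, A\<^sub>4\<close> along \<open>e\<^sub>2\<close> and \<open>A\<^sub>3\<close> along \<open>e\<^sub>3\<close>.  So a linear relation
among the columns is one between 1 and the nonconstant function \<open>l\<close>, and only \<open>Q\<^sub>1\<^sub>5\<close> and \<open>Q\<^sub>2\<^sub>4\<close> can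
be nonzero.\<close>

lemma normal_form_satisfies_conditions:
  fixes I :: "real set"
  assumes I: "open I" "is_interval I" "I \<noteq> {}"
    and nf: "is_normal_form_on I A R w b11 b12 b13 b22 b23 l"
  shows "columns_independent_on I A \<and> (\<forall>t\<in>I. det_conditions (A t)) \<and> Q_constant_on I A"
proof -
  have "R differentiable (at t)" if "t \<in> I" for t
    using nf smooth_on_imp_differentiable that unfolding is_normal_form_on_def by blast
  moreover have "vector_derivative R (at t) = 0" if "t \<in> I" for t
  proof -
    let ?D = "vector_derivative R (at t)"
    have "(transpose (R t) ** ?D) *v x = 0" for x
      using nf that by (auto simp: is_normal_form_on_def is_rotation_vector_def)
    then have "transpose (R t) ** ?D = 0"
      by (simp add: matrix_eq)
    moreover have "R t ** transpose (R t) = mat 1"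
      using nf that by (auto simp: is_normal_form_on_def rotation_matrix_def orthogonal_matrix_def)
    ultimately show ?thesis
      by (metis matrix_mul_assoc matrix_mul_lid times0_right)
  qed
  ultimately have "(R has_vector_derivative 0) (at t within I)" if "t \<in> I" for t
    using that by (metis has_vector_derivative_at_within vector_derivative_works)
  then obtain R0 where R0: "\<And>t. t \<in> I \<Longrightarrow> R t = R0"
    using has_vector_derivative_zero_constant[OF is_interval_convex[OF I(2)]] by blast
  define e where "e i = column i R0" for i
  obtain t0 where t0: "t0 \<in> I" using I by blast
  have rot: "rotation_matrix R0"
    using nf t0 R0 by (auto simp: is_normal_form_on_def)
  have "(transpose R0 ** R0) $ i $ j = e i \<bullet> e j" for i j
    by (simp add: matrix_matrix_mult_def transpose_def inner_vec_def e_def column_def)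
  then have e: "e i \<bullet> e j = (if i = j then 1 else 0)" for i j
    using rot by (simp add: rotation_matrix_def orthogonal_matrix_def mat_def)
  have "transpose (vector [e 1, e 2, e 3]) = R0"
    by (simp add: e_def column_def transpose_def vec_eq_iff forall_3)
  then have det_e: "det3 (e 1) (e 2) (e 3) = 1"
    using rot by (simp add: det3_def rotation_matrix_def)
  have nz: "b11 t \<noteq> 0" "l t \<noteq> 0" and l': "(l has_real_derivative - 1 / (b11 t)\<^sup>2) (at t)" if "t \<in> I" for t
    using nf that by (auto simp: is_normal_form_on_def)
  have b11': "\<exists>D. (b11 has_real_derivative D) (at t)" if "t \<in> I" for t
    using nf that smooth_on_imp_differentiable[of I b11 t]
    by (auto simp: is_normal_form_on_def real_differentiable_def)
  have cols: "column 1 (A t) = b11 t *\<^sub>R e 1" "column 2 (A t) = (l t * b11 t) *\<^sub>R e 2"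
    "column 3 (A t) = (1 / (b11 t * (l t * b11 t))) *\<^sub>R e 3"
    "column 4 (A t) = b11 t *\<^sub>R e 2" "column 5 (A t) = (l t * b11 t) *\<^sub>R e 1" if t: "t \<in> I" for t
  proof -
    have "A t = R0 ** B_matrix (b11 t) 0 0 (l t * b11 t) 0 (l t)"
      using nf t R0 by (auto simp: is_normal_form_on_def)
    then show "column 1 (A t) = b11 t *\<^sub>R e 1" "column 2 (A t) = (l t * b11 t) *\<^sub>R e 2"
      "column 3 (A t) = (1 / (b11 t * (l t * b11 t))) *\<^sub>R e 3"
      "column 4 (A t) = b11 t *\<^sub>R e 2" "column 5 (A t) = (l t * b11 t) *\<^sub>R e 1"
      using nz[OF t] by (simp_all add: columns_mult_B_matrix e_def)
  qed
  have "det_conditions (A t)" if t: "t \<in> I" for t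
    unfolding det_conditions_iff cols[OF t]
    using nz[OF t] by (auto simp: det3_linear det_e intro!: exI[of _ "l t"])
  moreover have "columns_independent_on I A"
    unfolding columns_independent_on_def
  proof (intro allI impI)
    fix c :: "5 \<Rightarrow> real" and i
    assume c: "\<forall>t\<in>I. (\<Sum>i\<in>UNIV. c i *\<^sub>R column i (A t)) = 0"
    have *: "c 1 + l t * c 5 = 0" "c 4 + l t * c 2 = 0" "c 3 = 0" if t: "t \<in> I" for t
    proof -
      have z: "(\<Sum>i\<in>UNIV. c i *\<^sub>R column i (A t)) \<bullet> e k = 0" for k
        using c t by simp
      have "b11 t * (c 1 + l t * c 5) = 0" "b11 t * (c 4 + l t * c 2) = 0" "c 3 / (b11 t * (l t * b11 t)) = 0"
        using z[of 1] z[of 2] z[of 3] unfolding sum_5 cols[OF t]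
        by (simp_all add: inner_add_left e algebra_simps)
      with nz[OF t] show "c 1 + l t * c 5 = 0" "c 4 + l t * c 2 = 0" "c 3 = 0" by simp_all
    qed
    have slope: "y = 0" if "\<And>t. t \<in> I \<Longrightarrow> x + l t * y = 0" for x y
    proof -
      have "((\<lambda>s. x + l s * y) has_real_derivative - 1 / (b11 t0)\<^sup>2 * y) (at t0)"
        using l'[OF t0] by (auto intro!: derivative_eq_intros)
      moreover have "((\<lambda>s. x + l s * y) has_real_derivative 0) (at t0)"
        by (rule has_field_derivative_transform_within_open[OF DERIV_const[of 0] I(1) t0]) (simp add: that)
      ultimately have "- 1 / (b11 t0)\<^sup>2 * y = 0" by (rule DERIV_unique)
      with nz[OF t0] show ?thesis by simp
    qed
    have "c 5 = 0" "c 2 = 0" using slope *(1,2) by blast+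
    moreover from this have "c 1 = 0" "c 4 = 0" "c 3 = 0" using *[OF t0] by simp_all
    ultimately show "c i = 0" using exhaust_5[of i] by auto
  qed
  moreover have "Q_constant_on I A"
  proof -
    define m h where "m s = l s * b11 s" and "h s = 1 / (b11 s * m s)" for s
    note cols' = cols[folded m_def, folded h_def]
    have "Q A 1 2 t = 0" "Q A 1 3 t = 0" "Q A 1 4 t = 0" "Q A 2 3 t = 0" "Q A 2 5 t = 0"
      "Q A 3 4 t = 0" "Q A 3 5 t = 0" "Q A 4 5 t = 0" "Q A 1 5 t = 1" "Q A 2 4 t = - 1"
      if t: "t \<in> I" for t
    proof -
      obtain a' where a': "(b11 has_real_derivative a') (at t)" using b11'[OF t] by blast
      have m': "(m has_real_derivative - 1 / b11 t + l t * a') (at t)"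
        using DERIV_mult[OF l'[OF t] a'] nz[OF t] unfolding m_def[abs_def]
        by (simp add: power2_eq_square mult.commute)
      have "b11 t * m t \<noteq> 0" using nz[OF t] by (simp add: m_def)
      from DERIV_divide[OF DERIV_const[of 1] DERIV_mult[OF a' m'] this]
      obtain h' where h': "(h has_real_derivative h') (at t)"
        unfolding h_def[abs_def] by blast
      have speed: "a' * m t - (- 1 / b11 t + l t * a') * b11 t = 1"
        "(- 1 / b11 t + l t * a') * b11 t - a' * m t = - 1"
        using nz[OF t] by (simp_all add: m_def field_simps)
      have Q: "Q A i j t = (f' * k t - k' * f t) * (u \<bullet> v)"
        if "\<And>s. s \<in> I \<Longrightarrow> column i (A s) = f s *\<^sub>R u" "\<And>s. s \<in> I \<Longrightarrow> column j (A s) = k s *\<^sub>R v"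
          "(f has_real_derivative f') (at t)" "(k has_real_derivative k') (at t)"
        for i j f f' k k' and u v :: "real^3"
      proof -
        have "Q A i j t = bracket (\<lambda>s. f s *\<^sub>R u) (\<lambda>s. k s *\<^sub>R v) t"
          unfolding Q_eq_bracket by (rule bracket_cong[OF I(1) t]) (simp_all add: that(1,2))
        then show ?thesis by (simp add: bracket_scaled_constants[OF that(3,4)])
      qed
      note c = cols'(1) cols'(2) cols'(3) cols'(4) cols'(5)
      show "Q A 1 2 t = 0"
        using Q[OF c(1,2) a' m'] by (simp add: e)
      show "Q A 1 3 t = 0"
        using Q[OF c(1,3) a' h'] by (simp add: e)
      show "Q A 1 4 t = 0"
        using Q[OF c(1,4) a' a'] by (simp add: e)
      show "Q A 2 3 t = 0"
        using Q[OF c(2,3) m' h'] by (simp add: e)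
      show "Q A 2 5 t = 0"
        using Q[OF c(2,5) m' m'] by (simp add: e)
      show "Q A 3 4 t = 0"
        using Q[OF c(3,4) h' a'] by (simp add: e)
      show "Q A 3 5 t = 0"
        using Q[OF c(3,5) h' m'] by (simp add: e)
      show "Q A 4 5 t = 0"
        using Q[OF c(4,5) a' m'] by (simp add: e)
      show "Q A 1 5 t = 1"
        using Q[OF c(1,5) a' m', unfolded speed] by (simp add: e)
      show "Q A 2 4 t = - 1"
        using Q[OF c(2,4) m' a', unfolded speed] by (simp add: e)
    qed
    then show ?thesis
      by (auto simp: Q_constant_on_def constant_on_def)
  qed
  ultimately show ?thesis by blast
qed

section \<open>The classification\<close>

theorem theorem5p3:
  fixes I :: "real set"
  assumes "open I" and "is_interval I" and "I \<noteq> {}"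
  shows "(\<forall>A :: real \<Rightarrow> real^5^3.
            smooth_on I A \<and> columns_independent_on I A \<and>
            (\<forall>t\<in>I. det_conditions (A t)) \<and> Q_constant_on I A \<longrightarrow>
            (\<exists>H :: real^5^5.
               invertible H \<and> preserves_spatial_constraints H \<and> preserves_det_conditions H \<and>
               (\<exists>R w b11 b12 b13 b22 b23 l.
                  is_normal_form_on I (\<lambda>t. A t ** H) R w b11 b12 b13 b22 b23 l \<and>
                  R constant_on I)))
       \<and> (\<forall>(A :: real \<Rightarrow> real^5^3) R w b11 b12 b13 b22 b23 l.
            is_normal_form_on I A R w b11 b12 b13 b22 b23 l \<longrightarrow>
            columns_independent_on I A \<and>
            (\<forall>t\<in>I. det_conditions (A t)) \<and> Q_constant_on I A)"
proof (intro conjI allI impI)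
  fix A :: "real \<Rightarrow> real^5^3"
  assume A: "smooth_on I A \<and> columns_independent_on I A \<and> (\<forall>t\<in>I. det_conditions (A t)) \<and> Q_constant_on I A"
  show "\<exists>H. invertible H \<and> preserves_spatial_constraints H \<and> preserves_det_conditions H \<and>
     (\<exists>R w b11 b12 b13 b22 b23 l.
        is_normal_form_on I (\<lambda>t. A t ** H) R w b11 b12 b13 b22 b23 l \<and> R constant_on I)"
    by (rule normal_form_exists[OF assms]) (use A in simp_all)
qed (use normal_form_satisfies_conditions[OF assms] in simp_all)

end
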